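(* Let $\mathcal{X}\subset\mathbb{R}^d$ be compact, $k$ a kernel on $\mathcal{X}$, $\sigma>0$, with $k^\sigma(x,y)\le B$ for all $x,y$. Let $f\in\mathcal{H}_k$, $g\in\mathcal{H}_{\sigma^2\delta}$, $h=f+g$. Let $T=NL$ and run Algorithm 4: for $n=1,\dots,N$ choose the batch $X_n=(x_{(n-1)L+1},\dots,x_{nL})$ as a maximizer over $X=(z_1,\dots,z_L)\in\mathcal{X}^L$ of $$\frac1L\sum_{i=1}^L\widehat m_{(n-1)L}(z_i)+\|h\|_{\mathcal{H}_{k^\sigma}}\left(2\sqrt{\frac{\operatorname{tr}(\widehat{\operatorname{cov}}_{n-1}(X,X))}{L}}-\sqrt{\frac{\mathbf{1}^T\widehat{\operatorname{cov}}_{n-1}(X,X)\mathbf{1}}{L^2}}\right),$$ then observe $h$ at all points of $X_n$. Assume maximizers exist and all queried points $x_1,\dots,x_T$ are pairwise distinct. Let $\beta=\max_{n\le N}\|\widehat{\operatorname{cov}}_{n-1}(X_n,X_n)\|_2>0$ and $C_4=\frac{8\beta}{\log(1+\beta\sigma^{-2})}$. Then $$R_T\le\|h\|_{\mathcal{H}_{k^\sigma}}\sqrt{TC_4\gamma_T}+2T\big(\|h\|_{\mathcal{H}_{k^\sigma}}+\|g\|_{\mathcal{H}_{\sigma^2\delta}}\big)\sigma,$$ $$r_T\le\|h\|_{\mathcal{H}_{k^\sigma}}\sqrt{\frac{C_4\gamma_T}{T}}+2\big(\|h\|_{\mathcal{H}_{k^\sigma}}+\|g\|_{\mathcal{H}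_{\sigma^2\delta}}\big)\sigma.$$
   Context: $\delta(x,y)=1$ if $x=y$, else $0$; $k^\sigma=k+\sigma^2\delta$; $\mathcal{H}_{\sigma^2\delta}$ is the RKHS of $\sigma^2\delta$. For query points $x_1,\dots,x_t$ with observations $y_i=h(x_i)$: $\mathbf{k}_t(x)=[k(x,x_i)]_{i\le t}$, $\mathbf{K}_t=[k(x_i,x_j)]_{i,j\le t}$, $\widehat m_t(x)=\mathbf{k}_t(x)^T(\mathbf{K}_t+\sigma^2I)^{-1}\mathbf{y}_t$ ($\widehat m_0\equiv0$). $\overline X_n=\{x_1,\dots,x_{nL}\}$; for an $L$-tuple $X$, $\widehat{\operatorname{cov}}_n(X,X)=\mathbf{K}(X,X)-\mathbf{K}(\overline X_n,X)^T(\sigma^2I+\mathbf{K}(\overline X_n,\overline X_n))^{-1}\mathbf{K}(\overline X_n,X)$, with $\widehat{\operatorname{cov}}_0=\mathbf{K}(X,X)$. $x^*\in\arg\max_{\mathcal{X}}f$; $R_T=\sum_{t=1}^T(f(x^* )-f(x_t))$; $r_T=f(x^* )-\max_{t\le T}f(x_t)$; $\gamma_T=\max_{x_1,\dots,x_T\in\mathcal{X}}\frac12\log\det(\mathbf{I}_T+\sigma^{-2}\mathbf{K}_T)$. *)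

theory Defs
  imports "HOL-Analysis.Analysis" "Jordan_Normal_Form.Determinant"
begin

section \<open>Reproducing kernels and RKHS norms (Moore--Aronszajn construction)\<close>

definition kernel_on :: "'a set \<Rightarrow> ('a \<Rightarrow> 'a \<Rightarrow> real) \<Rightarrow> bool" where
  "kernel_on X k \<longleftrightarrow> (\<forall>x\<in>X. \<forall>y\<in>X. k x y = k y x) \<and>
     (\<forall>S c. finite S \<and> S \<subseteq> X \<longrightarrow> (\<Sum>x\<in>S. \<Sum>y\<in>S. c x * c y * k x y) \<ge> 0)"

definition dirac :: "'a \<Rightarrow> 'a \<Rightarrow> real" where
  "dirac x y = (if x = y then 1 else 0)"

text \<open>Finite linear combinations sum_x c x * k(.,x), coefficients with finite support.\<close>
definition csupp :: "('a \<Rightarrow> real) \<Rightarrow> 'a set" where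
  "csupp c = {x. c x \<noteq> 0}"

definition pre_eval :: "('a \<Rightarrow> 'a \<Rightarrow> real) \<Rightarrow> ('a \<Rightarrow> real) \<Rightarrow> 'a \<Rightarrow> real" where
  "pre_eval k c y = (\<Sum>x\<in>csupp c. c x * k y x)"

definition pre_sqnorm :: "('a \<Rightarrow> 'a \<Rightarrow> real) \<Rightarrow> ('a \<Rightarrow> real) \<Rightarrow> real" where
  "pre_sqnorm k c = (\<Sum>x\<in>csupp c. \<Sum>y\<in>csupp c. c x * c y * k x y)"

definition rkhs_approx :: "('a \<Rightarrow> 'a \<Rightarrow> real) \<Rightarrow> 'a set \<Rightarrow> ('a \<Rightarrow> real) \<Rightarrow> (nat \<Rightarrow> 'a \<Rightarrow> real) \<Rightarrow> bool" where
  "rkhs_approx k X f cs \<longleftrightarrow>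
     (\<forall>n. finite (csupp (cs n)) \<and> csupp (cs n) \<subseteq> X) \<and>
     (\<forall>e>0. \<exists>N. \<forall>m\<ge>N. \<forall>n\<ge>N. pre_sqnorm k (\<lambda>x. cs m x - cs n x) < e) \<and>
     (\<forall>y\<in>X. (\<lambda>n. pre_eval k (cs n) y) \<longlonglongrightarrow> f y)"

definition rkhs_mem :: "('a \<Rightarrow> 'a \<Rightarrow> real) \<Rightarrow> 'a set \<Rightarrow> ('a \<Rightarrow> real) \<Rightarrow> bool" where
  "rkhs_mem k X f \<longleftrightarrow> (\<exists>cs. rkhs_approx k X f cs)"

definition rkhs_norm :: "('a \<Rightarrow> 'a \<Rightarrow> real) \<Rightarrow> 'a set \<Rightarrow> ('a \<Rightarrow> real) \<Rightarrow> real" where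
  "rkhs_norm k X f = (THE r. \<exists>cs. rkhs_approx k X f cs \<and> (\<lambda>n. sqrt (pre_sqnorm k (cs n))) \<longlonglongrightarrow> r)"

definition mat_inv :: "real mat \<Rightarrow> real mat" where
  "mat_inv A = (SOME B. B \<in> carrier_mat (dim_row A) (dim_row A) \<and>
                    A * B = 1\<^sub>m (dim_row A) \<and> B * A = 1\<^sub>m (dim_row A))"

definition mat_trace :: "real mat \<Rightarrow> real" where
  "mat_trace A = (\<Sum>i<dim_row A. A $$ (i, i))"

definition mat_sum_all :: "real mat \<Rightarrow> real" where
  "mat_sum_all A = (\<Sum>i<dim_row A. \<Sum>j<dim_col A. A $$ (i, j))"

definition vnorm2 :: "real vec \<Rightarrow> real" where
  "vnorm2 v = sqrt (\<Sum>i<dim_vec v. (v $ i)^2)"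

definition spec_norm :: "real mat \<Rightarrow> real" where
  "spec_norm A = Sup {vnorm2 (A *\<^sub>v v) | v. dim_vec v = dim_col A \<and> vnorm2 v = 1}"

definition kmat :: "('a \<Rightarrow> 'a \<Rightarrow> real) \<Rightarrow> 'a list \<Rightarrow> 'a list \<Rightarrow> real mat" where
  "kmat k P Q = mat (length P) (length Q) (\<lambda>(i, j). k (P ! i) (Q ! j))"

definition post_mean :: "('a \<Rightarrow> 'a \<Rightarrow> real) \<Rightarrow> real \<Rightarrow> 'a list \<Rightarrow> real list \<Rightarrow> 'a \<Rightarrow> real" where
  "post_mean k \<sigma> P ys z =
     vec (length P) (\<lambda>i. k z (P ! i)) \<bullet>
       (mat_inv (kmat k P P + \<sigma>\<^sup>2 \<cdot>\<^sub>m 1\<^sub>m (length P)) *\<^sub>v vec (length P) (\<lambda>i. ys ! i))"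

definition post_cov :: "('a \<Rightarrow> 'a \<Rightarrow> real) \<Rightarrow> real \<Rightarrow> 'a list \<Rightarrow> 'a list \<Rightarrow> real mat" where
  "post_cov k \<sigma> P Z =
     kmat k Z Z - transpose_mat (kmat k P Z) *
        (mat_inv (\<sigma>\<^sup>2 \<cdot>\<^sub>m 1\<^sub>m (length P) + kmat k P P) * kmat k P Z)"

definition info_gain :: "('a \<Rightarrow> 'a \<Rightarrow> real) \<Rightarrow> real \<Rightarrow> 'a set \<Rightarrow> nat \<Rightarrow> real" where
  "info_gain k \<sigma> X T = (SUP P \<in> {P. length P = T \<and> set P \<subseteq> X}.
       ln (det (1\<^sub>m T + (1 / \<sigma>\<^sup>2) \<cdot>\<^sub>m kmat k P P)) / 2)"

text \<open>Queried points are xs 1, ..., xs T (1-based).  First t points:\<close>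
definition first_pts :: "(nat \<Rightarrow> 'a) \<Rightarrow> nat \<Rightarrow> 'a list" where
  "first_pts xs t = map xs [1..<t + 1]"

definition batch :: "(nat \<Rightarrow> 'a) \<Rightarrow> nat \<Rightarrow> nat \<Rightarrow> 'a list" where
  "batch xs L n = map xs [(n - 1) * L + 1..<n * L + 1]"

text \<open>Acquisition value of candidate batch Z at round n, with hn = ||h||_{H_{k^sigma}}
  and observations y_i = h(x_i).\<close>
definition acq :: "('a \<Rightarrow> 'a \<Rightarrow> real) \<Rightarrow> real \<Rightarrow> ('a \<Rightarrow> real) \<Rightarrow> real \<Rightarrow> (nat \<Rightarrow> 'a) \<Rightarrow> nat \<Rightarrow> nat \<Rightarrow> 'a list \<Rightarrow> real" where
  "acq k \<sigma> h hn xs L n Z =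
     (let P = first_pts xs ((n - 1) * L); C = post_cov k \<sigma> P Z in
       (1 / real L) * (\<Sum>i<L. post_mean k \<sigma> P (map h P) (Z ! i))
       + hn * (2 * sqrt (mat_trace C / real L) - sqrt (mat_sum_all C / (real L)\<^sup>2)))"

end

theory Submission
  imports Defs "Jordan_Normal_Form.Schur_Decomposition"
begin

text \<open>
  Since \<open>f \<in> H\<^sub>k\<close> and \<open>g\<close> lies in the RKHS of \<open>\<sigma>\<^sup>2 \<delta>\<close>, the sum \<open>h\<close> lies in the RKHS of
  \<open>k\<^sup>\<sigma> = k + \<sigma>\<^sup>2 \<delta>\<close>, so a linear combination \<open>\<Sum> u\<^sub>i h(p\<^sub>i)\<close> is at most \<open>\<parallel>h\<parallel>\<close> times the square root of
  the \<open>k\<^sup>\<sigma>\<close>-form of \<open>u\<close>. Applied to the average error of the posterior mean over a batch \<open>Z\<close> of \<open>L\<close> new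
  points, the form is \<open>1\<^sup>T C 1 / L\<^sup>2 + \<sigma>\<^sup>2 / L\<close> with \<open>C\<close> the posterior covariance. Comparing the chosen
  batch with \<open>L\<close> copies of the maximizer \<open>x\<^sup>*\<close>, the terms \<open>\<surd>(1\<^sup>T C 1 / L\<^sup>2)\<close> cancel, and the average
  regret of the batch is at most \<open>2 \<parallel>h\<parallel> \<surd>(tr C / L)\<close> plus noise terms. By concavity of the logarithm,
  each eigenvalue \<open>\<lambda> \<le> \<beta>\<close> of \<open>C\<close> satisfies \<open>\<lambda> ln (1 + \<beta>/\<sigma>\<^sup>2) \<le> \<beta> ln (1 + \<lambda>/\<sigma>\<^sup>2)\<close>, and by Schur
  complements the \<open>ln det (I + C/\<sigma>\<^sup>2)\<close> of the batches add up to that of all queried points, which is at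
  most \<open>2 \<gamma>\<^sub>T\<close>.
\<close>

section \<open>Reproducing kernel Hilbert spaces\<close>

text \<open>The sum runs over an ambient set \<open>S\<close> instead of the support, so that
  coefficient functions with different supports can be compared over one common set.\<close>

definition kform :: "('a \<Rightarrow> 'a \<Rightarrow> real) \<Rightarrow> 'a set \<Rightarrow> ('a \<Rightarrow> real) \<Rightarrow> ('a \<Rightarrow> real) \<Rightarrow> real" where
  "kform K S a b = (\<Sum>x\<in>S. \<Sum>y\<in>S. a x * b y * K x y)"

lemma pre_sqnorm_eq_kform:
  assumes "finite S" "csupp c \<subseteq> S"
  shows "pre_sqnorm K c = kform K S c c"
proof -
  have inner: "(\<Sum>y\<in>csupp c. c x * c y * K x y) = (\<Sum>y\<in>S. c x * c y * K x y)" for x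
    by (rule sum.mono_neutral_left[OF assms]) (auto simp: csupp_def)
  show ?thesis
    unfolding pre_sqnorm_def kform_def inner
    by (rule sum.mono_neutral_left[OF assms]) (auto simp: csupp_def)
qed

lemma pre_eval_eq_sum:
  assumes "finite S" "csupp c \<subseteq> S"
  shows "pre_eval K c y = (\<Sum>x\<in>S. c x * K y x)"
  unfolding pre_eval_def
  by (rule sum.mono_neutral_left[OF assms]) (auto simp: csupp_def)

lemma kform_add_left: "kform K S (\<lambda>x. a x + b x) c = kform K S a c + kform K S b c"
  by (simp add: kform_def sum.distrib algebra_simps)

lemma kform_add_right: "kform K S c (\<lambda>x. a x + b x) = kform K S c a + kform K S c b"
  by (simp add: kform_def sum.distrib algebra_simps)

lemma kform_scale_left: "kform K S (\<lambda>x. t * a x) c = t * kform K S a c"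
  by (simp add: kform_def sum_distrib_left algebra_simps)

lemma kform_scale_right: "kform K S c (\<lambda>x. t * a x) = t * kform K S c a"
  by (simp add: kform_def sum_distrib_left algebra_simps)

lemma kform_nonneg: "kernel_on X K \<Longrightarrow> finite S \<Longrightarrow> S \<subseteq> X \<Longrightarrow> kform K S a a \<ge> 0"
  by (simp add: kernel_on_def kform_def)

lemma kform_commute:
  assumes "kernel_on X K" "S \<subseteq> X"
  shows "kform K S a b = kform K S b a"
  unfolding kform_def
  by (subst sum.swap, intro sum.cong refl) (use assms in \<open>auto simp: kernel_on_def subset_iff\<close>)

lemma kform_expand:
  assumes "kernel_on X K" "S \<subseteq> X"
  shows "kform K S (\<lambda>x. s * a x + t * b x) (\<lambda>x. s * a x + t * b x)
    = s\<^sup>2 * kform K S a a + 2 * s * t * kform K S a b + t\<^sup>2 * kform K S b b"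
  by (simp only: kform_add_left kform_add_right kform_scale_left kform_scale_right
      kform_commute[OF assms, of b a]) (simp add: algebra_simps power2_eq_square)

lemma kform_diff:
  assumes "kernel_on X K" "S \<subseteq> X"
  shows "kform K S (\<lambda>x. a x - b x) (\<lambda>x. a x - b x)
    = kform K S a a - 2 * kform K S a b + kform K S b b"
  using kform_expand[OF assms, of 1 a "-1" b] by simp

text \<open>The minimum over \<open>t\<close> is at \<open>- B / C\<close>. For
  \<open>C = 0\<close>, which occurs because kernel forms are only semidefinite, the expression is
  affine in \<open>t\<close> and nonnegativity forces \<open>B = 0\<close>.\<close>

lemma discriminant_le:
  fixes A B C :: real
  assumes nn: "\<And>t. A + 2 * t * B + t\<^sup>2 * C \<ge> 0" and "C \<ge> 0"
  shows "B\<^sup>2 \<le> A * C"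
proof (cases "C = 0")
  case True
  have "B = 0"
  proof (rule ccontr)
    assume "B \<noteq> 0"
    \<comment> \<open>At this \<open>t\<close> the affine expression equals
      \<open>-1\<close>.\<close>
    with nn[of "- (A + 1) / (2 * B)"] True show False by (simp add: field_simps)
  qed
  then show ?thesis using True by simp
next
  case False
  with nn[of "- B / C"] assms(2) show ?thesis
    by (simp add: field_simps power2_eq_square)
qed

lemma kform_Cauchy_Schwarz:
  assumes "kernel_on X K" "finite S" "S \<subseteq> X"
  shows "\<bar>kform K S a b\<bar> \<le> sqrt (kform K S a a) * sqrt (kform K S b b)"
proof -
  have "(kform K S a b)\<^sup>2 \<le> kform K S a a * kform K S b b"
  proof (rule discriminant_le)
    fix t
    show "0 \<le> kform K S a a + 2 * t * kform K S a b + t\<^sup>2 * kform K S b b"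
      using kform_expand[OF assms(1,3), of 1 a t b] kform_nonneg[OF assms, of "\<lambda>x. 1 * a x + t * b x"]
      by simp
  qed (rule kform_nonneg[OF assms])
  then have "sqrt ((kform K S a b)\<^sup>2) \<le> sqrt (kform K S a a * kform K S b b)"
    by (rule real_sqrt_le_mono)
  then show ?thesis by (simp add: real_sqrt_mult)
qed

text \<open>Reverse triangle inequality for the seminorm given by the square root of the form;
  Cauchy--Schwarz controls the mixed term.\<close>

lemma sqrt_kform_diff_le:
  assumes "kernel_on X K" "finite S" "S \<subseteq> X"
  shows "\<bar>sqrt (kform K S a a) - sqrt (kform K S b b)\<bar> \<le> sqrt (kform K S (\<lambda>x. a x - b x) (\<lambda>x. a x - b x))"
proof -
  let ?p = "sqrt (kform K S a a)" and ?q = "sqrt (kform K S b b)"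
  have "(?p - ?q)\<^sup>2 = kform K S a a - 2 * (?p * ?q) + kform K S b b"
    using kform_nonneg[OF assms] by (simp add: power2_diff)
  also have "\<dots> \<le> kform K S (\<lambda>x. a x - b x) (\<lambda>x. a x - b x)"
    using kform_Cauchy_Schwarz[OF assms, of a b] by (simp add: kform_diff[OF assms(1,3)])
  finally show ?thesis using real_sqrt_le_mono by fastforce
qed

lemma csupp_diff_subset: "csupp (\<lambda>x. a x - b x) \<subseteq> csupp a \<union> csupp b"
  by (auto simp: csupp_def)

section \<open>Approximating sequences and the RKHS norm\<close>

lemma rkhs_approx_supp:
  assumes "rkhs_approx K X f cs"
  shows "finite (csupp (cs n))" "csupp (cs n) \<subseteq> X"
  using assms by (auto simp: rkhs_approx_def)

text \<open>The reverse triangle inequality turns the Cauchy condition on coefficients into one on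
  norms. This is the existence half for the definite description in
  \<open>rkhs_norm\<close>.\<close>

lemma rkhs_approx_norm_convergent:
  assumes K: "kernel_on X K" and ap: "rkhs_approx K X f cs"
  shows "convergent (\<lambda>n. sqrt (pre_sqnorm K (cs n)))"
proof -
  have "Cauchy (\<lambda>n. sqrt (pre_sqnorm K (cs n)))"
  proof (rule metric_CauchyI)
    fix e :: real assume "e > 0"
    \<comment> \<open>\<open>rkhs_approx\<close> measures differences by squared norms, hence the
      threshold \<open>e\<^sup>2\<close>.\<close>
    then obtain N where N: "\<forall>m\<ge>N. \<forall>n\<ge>N. pre_sqnorm K (\<lambda>x. cs m x - cs n x) < e\<^sup>2"
      using ap unfolding rkhs_approx_def by (meson zero_less_power)
    have "dist (sqrt (pre_sqnorm K (cs m))) (sqrt (pre_sqnorm K (cs n))) < e" if "m \<ge> N" "n \<ge> N" for m n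
    proof -
      let ?S = "csupp (cs m) \<union> csupp (cs n)"
      have S: "finite ?S" "?S \<subseteq> X" using rkhs_approx_supp[OF ap] by auto
      have "dist (sqrt (pre_sqnorm K (cs m))) (sqrt (pre_sqnorm K (cs n)))
          \<le> sqrt (pre_sqnorm K (\<lambda>x. cs m x - cs n x))"
        using sqrt_kform_diff_le[OF K S, of "cs m" "cs n"]
        by (simp add: dist_real_def pre_sqnorm_eq_kform[OF S(1)] csupp_diff_subset)
      also have "\<dots> < sqrt (e\<^sup>2)" using N that by (intro real_sqrt_less_mono) blast
      finally show ?thesis using \<open>e > 0\<close> by simp
    qed
    then show "\<exists>M. \<forall>m\<ge>M. \<forall>n\<ge>M. dist (sqrt (pre_sqnorm K (cs m))) (sqrt (pre_sqnorm K (cs n))) < e"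
      by blast
  qed
  then show ?thesis by (simp add: Cauchy_convergent_iff)
qed

text \<open>This is the reproducing property for finite combinations; it turns sums of function
  values into kernel forms.\<close>

lemma sum_pre_eval_eq_kform:
  assumes "finite S" "csupp c \<subseteq> S"
  shows "(\<Sum>x\<in>S. a x * pre_eval K c x) = kform K S a c"
  by (simp add: pre_eval_eq_sum[OF assms] kform_def sum_distrib_left mult.assoc)

lemma rkhs_approx_pairing:
  assumes "rkhs_approx K X f cs" "finite S" "S \<subseteq> X"
  shows "(\<lambda>n. \<Sum>x\<in>S. c x * pre_eval K (cs n) x) \<longlonglongrightarrow> (\<Sum>x\<in>S. c x * f x)"
  using assms by (intro tendsto_sum tendsto_mult tendsto_const) (auto simp: rkhs_approx_def)

lemma kform_extend:
  assumes "finite T" "S \<subseteq> T"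
  shows "kform K T (\<lambda>x. if x \<in> S then c x else 0) (\<lambda>x. if x \<in> S then c x else 0) = kform K S c c"
proof -
  have i: "T \<inter> S = S" using assms by blast
  have "kform K T (\<lambda>x. if x \<in> S then c x else 0) (\<lambda>x. if x \<in> S then c x else 0)
     = (\<Sum>x\<in>T. if x \<in> S then \<Sum>y\<in>T. if y \<in> S then c x * c y * K x y else 0 else 0)"
    unfolding kform_def by (auto intro!: sum.cong)
  also have "\<dots> = kform K S c c"
    using assms by (simp add: kform_def sum.inter_restrict[symmetric] i)
  finally show ?thesis .
qed

text \<open>Cauchy--Schwarz for \<open>c\<close> against \<open>cs n\<close>, followed by the limit
  in \<open>n\<close>. So the norm limit of any approximating sequence bounds the functional that
  \<open>f\<close> induces on coefficients.\<close>

lemma rkhs_approx_bound: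
  assumes K: "kernel_on X K" and ap: "rkhs_approx K X f cs"
    and r: "(\<lambda>n. sqrt (pre_sqnorm K (cs n))) \<longlonglongrightarrow> r"
    and S: "finite S" "S \<subseteq> X"
  shows "\<bar>\<Sum>x\<in>S. c x * f x\<bar> \<le> r * sqrt (kform K S c c)"
proof (rule LIMSEQ_le)
  show "(\<lambda>n. \<bar>\<Sum>x\<in>S. c x * pre_eval K (cs n) x\<bar>) \<longlonglongrightarrow> \<bar>\<Sum>x\<in>S. c x * f x\<bar>"
    by (intro tendsto_rabs rkhs_approx_pairing[OF ap S])
  show "(\<lambda>n. sqrt (pre_sqnorm K (cs n)) * sqrt (kform K S c c)) \<longlonglongrightarrow> r * sqrt (kform K S c c)"
    by (intro tendsto_mult r tendsto_const)
  have "\<bar>\<Sum>x\<in>S. c x * pre_eval K (cs n) x\<bar> \<le> sqrt (pre_sqnorm K (cs n)) * sqrt (kform K S c c)" for n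
  proof -
    \<comment> \<open>\<open>c\<close> is arbitrary outside \<open>S\<close>, so it is cut off there
      before both functions are moved to the common set.\<close>
    let ?T = "S \<union> csupp (cs n)" and ?c = "\<lambda>x. if x \<in> S then c x else 0"
    have T: "finite ?T" "?T \<subseteq> X" using S rkhs_approx_supp[OF ap] by auto
    have i: "?T \<inter> S = S" by blast
    have "(\<Sum>x\<in>S. c x * pre_eval K (cs n) x) = (\<Sum>x\<in>?T. ?c x * pre_eval K (cs n) x)"
      using T(1) by (simp add: if_distrib[of "\<lambda>z. z * _"] sum.inter_restrict[symmetric] i cong: if_cong)
    also have "\<dots> = kform K ?T ?c (cs n)"
      by (rule sum_pre_eval_eq_kform[OF T(1)]) auto
    finally show ?thesis
      using kform_Cauchy_Schwarz[OF K T, of ?c "cs n"] T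
      by (simp add: kform_extend pre_sqnorm_eq_kform[OF T(1)] mult.commute)
  qed
  then show "\<exists>N. \<forall>n\<ge>N. \<bar>\<Sum>x\<in>S. c x * pre_eval K (cs n) x\<bar> \<le> sqrt (pre_sqnorm K (cs n)) * sqrt (kform K S c c)"
    by blast
qed

text \<open>Pair \<open>f\<close> with \<open>cs m\<close>: through \<open>cs\<close> the value is
  nearly \<open>r\<^sup>2\<close>, through \<open>cs'\<close> it is at most \<open>r' * q m\<close>.
  With the roles exchanged this makes the norm limit independent of the approximating
  sequence.\<close>

lemma rkhs_approx_limit_le:
  assumes K: "kernel_on X K" and ap: "rkhs_approx K X f cs" and ap': "rkhs_approx K X f cs'"
    and r: "(\<lambda>n. sqrt (pre_sqnorm K (cs n))) \<longlonglongrightarrow> r"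
    and r': "(\<lambda>n. sqrt (pre_sqnorm K (cs' n))) \<longlonglongrightarrow> r'"
  shows "r \<le> r'"
proof -
  define q where "q n = sqrt (pre_sqnorm K (cs n))" for n
  have q: "q \<longlonglongrightarrow> r" using r by (simp add: q_def[abs_def])
  have q2: "(q n)\<^sup>2 = pre_sqnorm K (cs n)" and q0: "q n \<ge> 0" for n
    using kform_nonneg[OF K rkhs_approx_supp[OF ap], of n "cs n"]
      pre_sqnorm_eq_kform[OF rkhs_approx_supp(1)[OF ap] order_refl, of K n]
    by (auto simp: q_def)
  have r0: "r \<ge> 0" using LIMSEQ_le_const[OF q] q0 by blast
  have r0': "r' \<ge> 0"
    using LIMSEQ_le_const[OF r', of 0]
      kform_nonneg[OF K rkhs_approx_supp[OF ap']]
      pre_sqnorm_eq_kform[OF rkhs_approx_supp(1)[OF ap'] order_refl, of K]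
    by (metis real_sqrt_ge_zero)
  have "r * r \<le> r' * r + e" if "e > 0" for e
  proof -
    obtain N where N: "\<And>m n. m \<ge> N \<Longrightarrow> n \<ge> N \<Longrightarrow> pre_sqnorm K (\<lambda>x. cs m x - cs n x) < e"
      using ap \<open>e > 0\<close> unfolding rkhs_approx_def by meson
    \<comment> \<open>Polarization: twice the form of \<open>cs m\<close> and \<open>cs n\<close> is
      the sum of their squared norms minus that of the difference, which is below \<open>e\<close>.
      The bound holds for all large \<open>n\<close>, hence in the limit.\<close>
    have "((q m)\<^sup>2 + r\<^sup>2 - e) / 2 \<le> r' * q m" if "m \<ge> N" for m
    proof -
      let ?S = "csupp (cs m)"
      have S: "finite ?S" "?S \<subseteq> X" using rkhs_approx_supp[OF ap] by auto
      have "((q m)\<^sup>2 + r\<^sup>2 - e) / 2 \<le> (\<Sum>x\<in>?S. cs m x * f x)"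
      proof (rule LIMSEQ_le)
        show "(\<lambda>n. ((q m)\<^sup>2 + (q n)\<^sup>2 - e) / 2) \<longlonglongrightarrow> ((q m)\<^sup>2 + r\<^sup>2 - e) / 2"
          by (intro tendsto_intros q) simp
        show "(\<lambda>n. \<Sum>x\<in>?S. cs m x * pre_eval K (cs n) x) \<longlonglongrightarrow> (\<Sum>x\<in>?S. cs m x * f x)"
          by (rule rkhs_approx_pairing[OF ap S])
        have "((q m)\<^sup>2 + (q n)\<^sup>2 - e) / 2 \<le> (\<Sum>x\<in>?S. cs m x * pre_eval K (cs n) x)" if "n \<ge> N" for n
        proof -
          let ?T = "?S \<union> csupp (cs n)"
          have T: "finite ?T" "?T \<subseteq> X" using rkhs_approx_supp[OF ap] by auto
          have "(\<Sum>x\<in>?S. cs m x * pre_eval K (cs n) x) = (\<Sum>x\<in>?T. cs m x * pre_eval K (cs n) x)"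
            by (rule sum.mono_neutral_left) (use T in \<open>auto simp: csupp_def\<close>)
          also have "\<dots> = kform K ?T (cs m) (cs n)"
            by (rule sum_pre_eval_eq_kform[OF T(1)]) auto
          finally show ?thesis
            using N[OF \<open>m \<ge> N\<close> \<open>n \<ge> N\<close>]
            by (simp add: q2 pre_sqnorm_eq_kform[OF T(1)] csupp_diff_subset kform_diff[OF K T(2)])
        qed
        then show "\<exists>N. \<forall>n\<ge>N. ((q m)\<^sup>2 + (q n)\<^sup>2 - e) / 2 \<le> (\<Sum>x\<in>?S. cs m x * pre_eval K (cs n) x)"
          by blast
      qed
      also have "\<dots> \<le> r' * q m"
        using rkhs_approx_bound[OF K ap' r' S, of "cs m"]
        by (simp add: q_def pre_sqnorm_eq_kform[OF S(1) order_refl])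
      finally show ?thesis .
    qed
    then have "(r\<^sup>2 + r\<^sup>2 - e) / 2 \<le> r' * r"
      by (intro LIMSEQ_le[of "\<lambda>m. ((q m)\<^sup>2 + r\<^sup>2 - e) / 2" _ "\<lambda>m. r' * q m"] tendsto_intros q) auto
    then show ?thesis using \<open>e > 0\<close> by (simp add: power2_eq_square)
  qed
  then have "r * r \<le> r' * r" by (rule field_le_epsilon)
  then show ?thesis using r0 r0' by (cases "r = 0") auto
qed

lemma rkhs_norm_eq:
  assumes K: "kernel_on X K" and ap: "rkhs_approx K X f cs"
    and r: "(\<lambda>n. sqrt (pre_sqnorm K (cs n))) \<longlonglongrightarrow> r"
  shows "rkhs_norm K X f = r"
  unfolding rkhs_norm_def
  using rkhs_approx_limit_le[OF K] ap r by (intro the_equality) (blast, metis order_antisym)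

text \<open>The source of all later error estimates: finite combinations of values of
  \<open>f\<close> are controlled by the kernel form of their coefficients.\<close>

lemma rkhs_norm_bound:
  assumes K: "kernel_on X K" and f: "rkhs_mem K X f" and S: "finite S" "S \<subseteq> X"
  shows "\<bar>\<Sum>x\<in>S. c x * f x\<bar> \<le> rkhs_norm K X f * sqrt (kform K S c c)"
proof -
  obtain cs where ap: "rkhs_approx K X f cs" using f by (auto simp: rkhs_mem_def)
  obtain r where r: "(\<lambda>n. sqrt (pre_sqnorm K (cs n))) \<longlonglongrightarrow> r"
    using rkhs_approx_norm_convergent[OF K ap] by (auto simp: convergent_def)
  show ?thesis using rkhs_approx_bound[OF K ap r S] rkhs_norm_eq[OF K ap r] by simp
qed

lemma rkhs_norm_nonneg:
  assumes K: "kernel_on X K" and f: "rkhs_mem K X f"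
  shows "rkhs_norm K X f \<ge> 0"
proof -
  obtain cs where ap: "rkhs_approx K X f cs" using f by (auto simp: rkhs_mem_def)
  obtain r where r: "(\<lambda>n. sqrt (pre_sqnorm K (cs n))) \<longlonglongrightarrow> r"
    using rkhs_approx_norm_convergent[OF K ap] by (auto simp: convergent_def)
  have "r \<ge> 0"
    using LIMSEQ_le_const[OF r, of 0]
      kform_nonneg[OF K rkhs_approx_supp[OF ap]]
      pre_sqnorm_eq_kform[OF rkhs_approx_supp(1)[OF ap] order_refl, of K]
    by (metis real_sqrt_ge_zero)
  then show ?thesis using rkhs_norm_eq[OF K ap r] by simp
qed

text \<open>The functional \<open>J c = 2 \<Sum> c x h x - Q c\<close> is bounded above when \<open>h\<close> is a bounded functional;
  by the parallelogram law every maximizing sequence is Cauchy, and its limit represents \<open>h\<close>.\<close>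
lemma rkhs_mem_if_bounded:
  assumes K: "kernel_on X K"
    and bd: "\<And>S c. finite S \<Longrightarrow> S \<subseteq> X \<Longrightarrow> \<bar>\<Sum>x\<in>S. c x * h x\<bar> \<le> r * sqrt (kform K S c c)"
  shows "rkhs_mem K X h"
proof -
  define D where "D = {c. finite (csupp c) \<and> csupp c \<subseteq> X}"
  define J where "J c = 2 * (\<Sum>x\<in>csupp c. c x * h x) - pre_sqnorm K c" for c
  have J_eq: "J c = 2 * (\<Sum>x\<in>S. c x * h x) - kform K S c c" if "finite S" "csupp c \<subseteq> S" for c S
  proof -
    have "(\<Sum>x\<in>csupp c. c x * h x) = (\<Sum>x\<in>S. c x * h x)"
      by (rule sum.mono_neutral_left[OF that]) (auto simp: csupp_def)
    then show ?thesis by (simp add: J_def pre_sqnorm_eq_kform[OF that])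
  qed
  have J_le: "J c \<le> r\<^sup>2" if "c \<in> D" for c
  proof -
    let ?S = "csupp c"
    have S: "finite ?S" "?S \<subseteq> X" using that by (auto simp: D_def)
    define q where "q = sqrt (kform K ?S c c)"
    have "q\<^sup>2 = kform K ?S c c" using kform_nonneg[OF K S] by (simp add: q_def)
    then have "J c \<le> 2 * (r * q) - q\<^sup>2"
      using bd[OF S, of c] by (simp add: J_eq[OF S(1) order_refl] q_def)
    also have "\<dots> \<le> r\<^sup>2" using zero_le_power2[of "r - q"] by (simp add: power2_diff)
    finally show ?thesis .
  qed
  have bdd: "bdd_above (J ` D)" using J_le by (auto simp: bdd_above_def)
  have "(\<lambda>_. 0) \<in> D" by (simp add: D_def csupp_def)
  then have ne: "J ` D \<noteq> {}" by blast
  define s where "s = Sup (J ` D)"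
  have Js: "J c \<le> s" if "c \<in> D" for c
    unfolding s_def using that bdd by (simp add: cSup_upper)
  have "\<exists>c\<in>D. J c > s - 1 / real (Suc n)" for n
    using less_cSupD[OF ne, of "s - 1 / real (Suc n)"] by (auto simp: s_def)
  then obtain cs where csD: "\<And>n. cs n \<in> D" and csJ: "\<And>n. J (cs n) > s - 1 / real (Suc n)"
    by metis
  have fin: "finite (csupp (cs n))" "csupp (cs n) \<subseteq> X" for n using csD by (auto simp: D_def)
  have cau: "pre_sqnorm K (\<lambda>x. cs m x - cs n x) \<le> 2 * (1 / real (Suc m)) + 2 * (1 / real (Suc n))" for m n
  proof -
    let ?S = "csupp (cs m) \<union> csupp (cs n)"
    have S: "finite ?S" "?S \<subseteq> X" using fin by auto
    \<comment> \<open>By concavity of \<open>J\<close> the midpoint of two near-maximizers gains a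
      quarter of their squared distance over the average of their values; since it cannot exceed
      \<open>s\<close>, the distance is small.\<close>
    let ?a = "\<lambda>x. 1/2 * cs m x + 1/2 * cs n x"
    have sub: "csupp ?a \<subseteq> ?S" by (auto simp: csupp_def)
    then have "?a \<in> D" using S by (auto simp: D_def intro: finite_subset)
    then have "J ?a \<le> s" by (rule Js)
    moreover have "J ?a = (J (cs m) + J (cs n)) / 2 + pre_sqnorm K (\<lambda>x. cs m x - cs n x) / 4"
      by (simp only: J_eq[OF S(1) sub] J_eq[OF S(1) Un_upper1] J_eq[OF S(1) Un_upper2]
          kform_expand[OF K S(2)] pre_sqnorm_eq_kform[OF S(1) csupp_diff_subset] kform_diff[OF K S(2)])
        (simp add: sum.distrib sum_divide_distrib[symmetric] field_simps power2_eq_square)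
    moreover have "q \<le> 2 * a + 2 * b" if "j \<le> s" "j = (y + z) / 2 + q / 4" "s - a < y" "s - b < z" for q a b j y z :: real
      using that by argo
    ultimately show ?thesis using csJ[of m] csJ[of n] by blast
  qed
  have ev: "(h y - pre_eval K (cs n) y)\<^sup>2 \<le> (K y y + 1) * (1 / real (Suc n))" if "y \<in> X" for y n
  proof -
    let ?S = "insert y (csupp (cs n))"
    have S: "finite ?S" "?S \<subseteq> X" using fin that by auto
    define d where "d = h y - pre_eval K (cs n) y"
    let ?e = "\<lambda>x. if x = y then 1 else 0 :: real"
    \<comment> \<open>Moving from \<open>cs n\<close> by \<open>t\<close> times the point mass at
      \<open>y\<close> changes \<open>J\<close> by \<open>2 * t * d - t\<^sup>2 * K y y\<close>. The
      best \<open>t\<close> would be \<open>d / K y y\<close>; adding 1 keeps the denominator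
      positive when \<open>K y y = 0\<close>.\<close>
    define t where "t = d / (K y y + 1)"
    let ?a = "\<lambda>x. 1 * cs n x + t * ?e x"
    have sub: "csupp ?a \<subseteq> ?S" by (auto simp: csupp_def)
    then have "?a \<in> D" using S by (auto simp: D_def intro: finite_subset)
    then have le: "J ?a \<le> s" by (rule Js)
    have ee: "kform K ?S ?e ?e = K y y"
      using S(1) by (simp add: kform_def if_distrib[of "\<lambda>z. z * _"] if_distrib[of "\<lambda>z. _ * z"] sum.delta cong: if_cong)
    have kyy: "K y y \<ge> 0" using kform_nonneg[OF K S, of ?e] ee by simp
    have ce: "kform K ?S (cs n) ?e = pre_eval K (cs n) y"
    proof -
      have "kform K ?S (cs n) ?e = kform K ?S ?e (cs n)" by (rule kform_commute[OF K S(2)])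
      also have "\<dots> = (\<Sum>x\<in>?S. ?e x * pre_eval K (cs n) x)"
        by (rule sum_pre_eval_eq_kform[symmetric, OF S(1)]) auto
      also have "\<dots> = pre_eval K (cs n) y"
        using S(1) by (simp add: if_distrib[of "\<lambda>z. z * _"] sum.delta cong: if_cong)
      finally show ?thesis .
    qed
    have he: "(\<Sum>x\<in>?S. ?a x * h x) = (\<Sum>x\<in>?S. cs n x * h x) + t * h y"
    proof -
      have "(\<Sum>x\<in>?S. ?a x * h x) = (\<Sum>x\<in>?S. cs n x * h x) + (\<Sum>x\<in>?S. if x = y then t * h y else 0)"
        unfolding sum.distrib[symmetric] by (rule sum.cong) (auto simp: algebra_simps)
      then show ?thesis using S(1) by simp
    qed
    have "J ?a = J (cs n) + 2 * t * d - t\<^sup>2 * K y y"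
      by (simp only: J_eq[OF S(1) sub] J_eq[OF S(1) subset_insertI] kform_expand[OF K S(2)] ee ce he d_def)
        (simp add: algebra_simps)
    moreover have "2 * t * d - t\<^sup>2 * K y y \<ge> d\<^sup>2 / (K y y + 1)"
    proof -
      have "t * (K y y + 1) = d" using kyy by (simp add: t_def)
      then have "t\<^sup>2 * K y y + t\<^sup>2 = t * d" by (metis power2_eq_square distrib_left mult.assoc mult.right_neutral)
      moreover have "t * d = d\<^sup>2 / (K y y + 1)" by (simp add: t_def power2_eq_square)
      moreover have "2 * t * d = 2 * (t * d)" "t\<^sup>2 \<ge> 0" by simp_all
      ultimately show ?thesis by linarith
    qed
    ultimately have "d\<^sup>2 / (K y y + 1) \<le> 1 / real (Suc n)" using le csJ[of n] by linarith
    then show ?thesis using kyy by (simp add: d_def field_simps)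
  qed
  have "rkhs_approx K X h cs"
    unfolding rkhs_approx_def
  proof (intro conjI allI impI ballI)
    fix e :: real assume "e > 0"
    \<comment> \<open>By \<open>cau\<close> the squared distance beyond \<open>M\<close> is at most
      four times \<open>1 / real (Suc M)\<close>.\<close>
    then obtain M where M: "1 / real (Suc M) < e / 4" using nat_approx_posE[of "e/4"] by auto
    have "pre_sqnorm K (\<lambda>x. cs m x - cs n x) < e" if "m \<ge> M" "n \<ge> M" for m n
    proof -
      have "1 / real (Suc m) \<le> 1 / real (Suc M)" "1 / real (Suc n) \<le> 1 / real (Suc M)"
        using that by (simp_all add: frac_le)
      then show ?thesis using cau[of m n] M by simp
    qed
    then show "\<exists>N. \<forall>m\<ge>N. \<forall>n\<ge>N. pre_sqnorm K (\<lambda>x. cs m x - cs n x) < e" by blast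
  next
    fix y assume y: "y \<in> X"
    have "(\<lambda>n. (K y y + 1) * (1 / real (Suc n))) \<longlonglongrightarrow> (K y y + 1) * 0"
      by (intro tendsto_mult tendsto_const LIMSEQ_Suc lim_1_over_n)
    then have lim: "(\<lambda>n. (K y y + 1) * (1 / real (Suc n))) \<longlonglongrightarrow> 0" by simp
    have "(\<lambda>n. (h y - pre_eval K (cs n) y)\<^sup>2) \<longlonglongrightarrow> 0"
      by (rule Lim_null_comparison[OF _ lim]) (use ev[OF y] in auto)
    then have "(\<lambda>n. sqrt ((h y - pre_eval K (cs n) y)\<^sup>2)) \<longlonglongrightarrow> sqrt 0" by (rule tendsto_real_sqrt)
    then have "(\<lambda>n. h y - pre_eval K (cs n) y) \<longlonglongrightarrow> 0" by (simp add: tendsto_rabs_zero_iff)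
    then have "(\<lambda>n. h y - (h y - pre_eval K (cs n) y)) \<longlonglongrightarrow> h y - 0" by (intro tendsto_diff tendsto_const)
    then show "(\<lambda>n. pre_eval K (cs n) y) \<longlonglongrightarrow> h y" by simp
  qed (use fin in auto)
  then show ?thesis by (auto simp: rkhs_mem_def)
qed

section \<open>Sums of kernels and the kernel of the noise\<close>

lemma kform_add_kernel: "kform (\<lambda>x y. K x y + K' x y) S a b = kform K S a b + kform K' S a b"
  by (simp add: kform_def sum.distrib algebra_simps)

lemma kernel_on_add:
  assumes "kernel_on X K" "kernel_on X K'"
  shows "kernel_on X (\<lambda>x y. K x y + K' x y)"
  using assms unfolding kernel_on_def by (auto simp: distrib_left sum.distrib intro!: add_nonneg_nonneg)

text \<open>Each summand kernel has a smaller form than the sum, so the two norm bounds add up to a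
  bound for the sum of the functions, and the criterion \<open>rkhs_mem_if_bounded\<close>
  applies.\<close>

lemma rkhs_mem_add:
  assumes K: "kernel_on X K" and K': "kernel_on X K'" and f: "rkhs_mem K X f" and g: "rkhs_mem K' X g"
  shows "rkhs_mem (\<lambda>x y. K x y + K' x y) X (\<lambda>x. f x + g x)"
proof (rule rkhs_mem_if_bounded[OF kernel_on_add[OF K K']])
  fix S c assume S: "finite S" "S \<subseteq> X"
  let ?q = "sqrt (kform (\<lambda>x y. K x y + K' x y) S c c)"
  have q: "sqrt (kform K S c c) \<le> ?q" "sqrt (kform K' S c c) \<le> ?q"
    using kform_nonneg[OF K S] kform_nonneg[OF K' S] by (auto simp: kform_add_kernel)
  have "\<bar>\<Sum>x\<in>S. c x * (f x + g x)\<bar> \<le> \<bar>\<Sum>x\<in>S. c x * f x\<bar> + \<bar>\<Sum>x\<in>S. c x * g x\<bar>"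
    by (simp add: distrib_left sum.distrib)
  also have "\<dots> \<le> rkhs_norm K X f * ?q + rkhs_norm K' X g * ?q"
    using rkhs_norm_bound[OF K f S, of c] rkhs_norm_bound[OF K' g S, of c]
      mult_left_mono[OF q(1) rkhs_norm_nonneg[OF K f]] mult_left_mono[OF q(2) rkhs_norm_nonneg[OF K' g]]
    by linarith
  finally show "\<bar>\<Sum>x\<in>S. c x * (f x + g x)\<bar> \<le> (rkhs_norm K X f + rkhs_norm K' X g) * ?q"
    by (simp add: distrib_right)
qed

lemma kform_dirac: "finite S \<Longrightarrow> kform (\<lambda>x y. s * dirac x y) S c c = s * (\<Sum>x\<in>S. (c x)\<^sup>2)"
  by (simp add: kform_def dirac_def if_distrib[of "\<lambda>z. _ * z"] sum.delta' sum_distrib_left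
      power2_eq_square mult_ac cong: if_cong)

lemma kernel_on_dirac: "s \<ge> 0 \<Longrightarrow> kernel_on X (\<lambda>x y. s * dirac x y)"
  unfolding kernel_on_def kform_def[symmetric]
  by (auto simp: kform_dirac sum_nonneg) (auto simp: dirac_def)

text \<open>Indexed points may repeat, for instance when a new point is among the data; the
  coefficients of equal points are collected into one.\<close>

lemma sum_index_eq_sum_set:
  fixes u :: "nat \<Rightarrow> real"
  assumes "finite S" "\<And>i. i < n \<Longrightarrow> p i \<in> S"
  shows "(\<Sum>x\<in>S. (\<Sum>i<n. if p i = x then u i else 0) * F x) = (\<Sum>i<n. u i * F (p i))"
proof -
  have "(\<Sum>x\<in>S. (\<Sum>i<n. if p i = x then u i else 0) * F x)
      = (\<Sum>i<n. \<Sum>x\<in>S. (if p i = x then u i else 0) * F x)"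
    by (simp add: sum_distrib_right sum.swap[of _ S])
  also have "\<dots> = (\<Sum>i<n. u i * F (p i))"
    using assms by (intro sum.cong) (auto simp: if_distrib[of "\<lambda>z. z * _"] cong: if_cong)
  finally show ?thesis .
qed

lemma kform_index_eq_sum_set:
  fixes u :: "nat \<Rightarrow> real"
  assumes "finite S" "\<And>i. i < n \<Longrightarrow> p i \<in> S"
  shows "kform K S (\<lambda>x. \<Sum>i<n. if p i = x then u i else 0) (\<lambda>x. \<Sum>i<n. if p i = x then u i else 0)
    = (\<Sum>i<n. \<Sum>j<n. u i * u j * K (p i) (p j))" (is "kform K S ?c ?c = _")
proof -
  have "kform K S c c = (\<Sum>x\<in>S. c x * (\<Sum>y\<in>S. c y * K x y))" for c
    unfolding kform_def by (simp only: sum_distrib_left mult.assoc)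
  then have "kform K S ?c ?c = (\<Sum>x\<in>S. ?c x * (\<Sum>y\<in>S. ?c y * K x y))" .
  also have "\<dots> = (\<Sum>i<n. u i * (\<Sum>j<n. u j * K (p i) (p j)))"
    by (simp only: sum_index_eq_sum_set[OF assms])
  finally show ?thesis by (simp only: sum_distrib_left mult.assoc)
qed

lemma rkhs_norm_bound_indexed:
  fixes p :: "nat \<Rightarrow> 'a"
  assumes K: "kernel_on X K" and f: "rkhs_mem K X f" and p: "\<And>i. i < n \<Longrightarrow> p i \<in> X"
  shows "\<bar>\<Sum>i<n. u i * f (p i)\<bar> \<le> rkhs_norm K X f * sqrt (\<Sum>i<n. \<Sum>j<n. u i * u j * K (p i) (p j))"
proof -
  let ?S = "p ` {..<n}"
  have S: "finite ?S" "?S \<subseteq> X" using p by auto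
  have ps: "p i \<in> ?S" if "i < n" for i using that by auto
  show ?thesis
    using rkhs_norm_bound[OF K f S, of "\<lambda>x. \<Sum>i<n. if p i = x then u i else 0"]
    by (simp only: sum_index_eq_sum_set[OF S(1) ps] kform_index_eq_sum_set[OF S(1) ps])
qed

lemma kernel_on_nonneg_indexed:
  fixes p :: "nat \<Rightarrow> 'a"
  assumes K: "kernel_on X K" and p: "\<And>i. i < n \<Longrightarrow> p i \<in> X"
  shows "(\<Sum>i<n. \<Sum>j<n. u i * u j * K (p i) (p j)) \<ge> 0"
proof -
  let ?S = "p ` {..<n}"
  have S: "finite ?S" "?S \<subseteq> X" using p by auto
  have ps: "p i \<in> ?S" if "i < n" for i using that by auto
  show ?thesis
    using kform_nonneg[OF K S, of "\<lambda>x. \<Sum>i<n. if p i = x then u i else 0"]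
    by (simp only: kform_index_eq_sum_set[OF S(1) ps])
qed

section \<open>Spectra of positive semidefinite matrices\<close>

lemma mult_mat_vec_index_sum:
  assumes "A \<in> carrier_mat n m" "v \<in> carrier_vec m" "i < n"
  shows "(A *\<^sub>v v) $ i = (\<Sum>j<m. A $$ (i, j) * v $ j)"
  using assms by (auto simp: scalar_prod_def lessThan_atLeast0 intro!: sum.cong)

lemma mult_mat_index_sum:
  assumes "A \<in> carrier_mat n m" "B \<in> carrier_mat m l" "i < n" "j < l"
  shows "(A * B) $$ (i, j) = (\<Sum>k<m. A $$ (i, k) * B $$ (k, j))"
  using assms by (auto simp: scalar_prod_def lessThan_atLeast0 intro!: sum.cong)

text \<open>The supremum in \<open>spec_norm\<close> is over a bounded set: by Cauchy--Schwarz in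
  each row, the Frobenius norm is an upper bound.\<close>

lemma spec_norm_upper:
  assumes C: "C \<in> carrier_mat n n" and v: "v \<in> carrier_vec n" "vnorm2 v = 1"
  shows "vnorm2 (C *\<^sub>v v) \<le> spec_norm C"
proof -
  let ?S = "{vnorm2 (C *\<^sub>v v) | v. dim_vec v = dim_col C \<and> vnorm2 v = 1}"
  have "y \<le> sqrt (\<Sum>i<n. \<Sum>j<n. (C $$ (i, j))\<^sup>2)" if y: "y \<in> ?S" for y
  proof -
    obtain w where w0: "y = vnorm2 (C *\<^sub>v w)" "dim_vec w = dim_col C" "vnorm2 w = 1"
      using y by blast
    have wn: "w \<in> carrier_vec n"
      by (rule carrier_vecI) (rule w0(2)[unfolded carrier_matD(2)[OF C]])
    note w = w0(1) wn w0(3)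
    have w1: "(\<Sum>j<n. (w $ j)\<^sup>2) = 1"
      using w(3) by (simp add: vnorm2_def carrier_vecD[OF wn])
    have "(\<Sum>i<n. ((C *\<^sub>v w) $ i)\<^sup>2) \<le> (\<Sum>i<n. \<Sum>j<n. (C $$ (i, j))\<^sup>2)"
    proof (rule sum_mono)
      fix i assume "i \<in> {..<n}"
      then have "((C *\<^sub>v w) $ i)\<^sup>2 = (\<Sum>j<n. C $$ (i, j) * w $ j)\<^sup>2"
        using mult_mat_vec_index_sum[OF C w(2), of i] by simp
      also have "\<dots> \<le> (\<Sum>j<n. (C $$ (i, j))\<^sup>2) * (\<Sum>j<n. (w $ j)\<^sup>2)"
        by (rule Cauchy_Schwarz_ineq_sum)
      finally show "((C *\<^sub>v w) $ i)\<^sup>2 \<le> (\<Sum>j<n. (C $$ (i, j))\<^sup>2)" by (simp add: w1)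
    qed
    then show ?thesis using C by (simp add: w(1) vnorm2_def del: index_mult_mat_vec)
  qed
  then have "bdd_above ?S" by (rule bdd_aboveI)
  moreover have "vnorm2 (C *\<^sub>v v) \<in> ?S"
    using v carrier_matD(2)[OF C] carrier_vecD[OF v(1)] by blast
  ultimately show ?thesis unfolding spec_norm_def by (rule cSup_upper[rotated])
qed

text \<open>The Rayleigh quotient of \<open>x\<close> is \<open>e\<close>, and the normalized
  \<open>x\<close> is a unit vector whose image has length \<open>e\<close>. The eigenvector is a
  plain function so that real and imaginary parts can be inserted.\<close>

lemma psd_real_eigenpair_bounds:
  assumes C: "C \<in> carrier_mat n n"
    and psd: "\<And>u. 0 \<le> (\<Sum>i<n. \<Sum>j<n. u i * u j * C $$ (i, j))"
    and ev: "\<And>i. i < n \<Longrightarrow> (\<Sum>j<n. C $$ (i, j) * x j) = e * x i"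
    and nz: "\<exists>i<n. x i \<noteq> 0"
  shows "0 \<le> e" "e \<le> spec_norm C"
proof -
  define s where "s = (\<Sum>i<n. (x i)\<^sup>2)"
  obtain i0 where "i0 < n" "x i0 \<noteq> 0" using nz by blast
  then have s: "s > 0" unfolding s_def by (intro sum_pos2[of _ i0]) auto
  have "(\<Sum>i<n. \<Sum>j<n. x i * x j * C $$ (i, j)) = (\<Sum>i<n. x i * (\<Sum>j<n. C $$ (i, j) * x j))"
    by (simp add: sum_distrib_left mult_ac)
  also have "\<dots> = e * s"
    unfolding s_def sum_distrib_left[of e] by (intro sum.cong) (auto simp: ev power2_eq_square)
  finally show e: "0 \<le> e" using psd[of x] s by (simp add: zero_le_mult_iff)
  define v where "v = vec n (\<lambda>i. x i / sqrt s)"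
  have v: "v \<in> carrier_vec n" by (simp add: v_def)
  have v1: "(\<Sum>i<n. (v $ i)\<^sup>2) = 1"
    using s by (simp add: v_def power_divide sum_divide_distrib[symmetric] flip: s_def)
  then have "vnorm2 v = 1" using v by (simp add: vnorm2_def)
  moreover have "(C *\<^sub>v v) $ i = e * v $ i" if "i < n" for i
    using ev[OF that] that
    by (simp add: mult_mat_vec_index_sum[OF C v that]) (simp add: v_def sum_divide_distrib[symmetric])
  then have "(\<Sum>i<n. ((C *\<^sub>v v) $ i)\<^sup>2) = e\<^sup>2 * (\<Sum>i<n. (v $ i)\<^sup>2)"
    by (simp add: power_mult_distrib sum_distrib_left)
  then have "vnorm2 (C *\<^sub>v v) = e" using C e by (simp add: vnorm2_def v1)
  ultimately show "e \<le> spec_norm C" using spec_norm_upper[OF C v] by simp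
qed

text \<open>Write an eigenvector as \<open>x + i y\<close>. Symmetry of \<open>C\<close> forces the
  imaginary part of \<open>a\<close> to vanish; then \<open>x\<close> and \<open>y\<close> satisfy
  the real eigenvalue equation for \<open>Re a\<close>, and at least one of them is nonzero.\<close>

lemma psd_complex_eigenvalue:
  assumes C: "C \<in> carrier_mat n n"
    and sym: "\<And>i j. i < n \<Longrightarrow> j < n \<Longrightarrow> C $$ (i, j) = C $$ (j, i)"
    and psd: "\<And>u. 0 \<le> (\<Sum>i<n. \<Sum>j<n. u i * u j * C $$ (i, j))"
    and a: "eigenvalue (map_mat complex_of_real C) a"
  shows "Im a = 0" "0 \<le> Re a" "Re a \<le> spec_norm C"
proof -
  let ?C = "map_mat complex_of_real C"
  have cC: "?C \<in> carrier_mat n n" using C by simp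
  obtain v where v: "v \<in> carrier_vec n" "v \<noteq> 0\<^sub>v n" "?C *\<^sub>v v = a \<cdot>\<^sub>v v"
    using a C by (auto simp: eigenvalue_def eigenvector_def)
  define x where "x i = Re (v $ i)" for i
  define y where "y i = Im (v $ i)" for i
  have ev: "(\<Sum>j<n. complex_of_real (C $$ (i, j)) * v $ j) = a * v $ i" if "i < n" for i
    using mult_mat_vec_index_sum[OF cC v(1) that] that C v by simp
  have evx: "(\<Sum>j<n. C $$ (i, j) * x j) = Re a * x i - Im a * y i" if "i < n" for i
    using arg_cong[OF ev[OF that], of Re] by (simp add: x_def y_def)
  have evy: "(\<Sum>j<n. C $$ (i, j) * y j) = Re a * y i + Im a * x i" if "i < n" for i
    using arg_cong[OF ev[OF that], of Im] by (simp add: x_def y_def)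
  have nz: "\<exists>i<n. x i \<noteq> 0 \<or> y i \<noteq> 0"
  proof (rule ccontr)
    assume "\<not> ?thesis"
    then have "v = 0\<^sub>v n" using v(1) by (intro eq_vecI) (auto simp: x_def y_def complex_eq_iff)
    then show False using v(2) by simp
  qed
  \<comment> \<open>Pairing \<open>evx\<close> with \<open>y\<close> and \<open>evy\<close> with
    \<open>x\<close> gives equal sums by symmetry; their difference is \<open>Im a\<close> times the
    squared length of the eigenvector.\<close>
  have "(\<Sum>i<n. y i * (\<Sum>j<n. C $$ (i, j) * x j)) = (\<Sum>i<n. \<Sum>j<n. x j * (C $$ (j, i) * y i))"
    by (auto simp: sum_distrib_left sym mult_ac intro!: sum.cong)
  also have "\<dots> = (\<Sum>i<n. x i * (\<Sum>j<n. C $$ (i, j) * y j))"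
    by (subst sum.swap) (simp add: sum_distrib_left)
  finally have "(\<Sum>i<n. y i * (Re a * x i - Im a * y i)) = (\<Sum>i<n. x i * (Re a * y i + Im a * x i))"
    by (simp add: evx evy)
  then have "(\<Sum>i<n. x i * (Re a * y i + Im a * x i) - y i * (Re a * x i - Im a * y i)) = 0"
    by (simp only: sum_subtractf)
  then have "(\<Sum>i<n. Im a * ((x i)\<^sup>2 + (y i)\<^sup>2)) = 0"
    by (simp add: algebra_simps power2_eq_square)
  then have "Im a * (\<Sum>i<n. (x i)\<^sup>2 + (y i)\<^sup>2) = 0"
    by (simp only: sum_distrib_left)
  moreover have "(\<Sum>i<n. (x i)\<^sup>2 + (y i)\<^sup>2) > 0"
  proof -
    obtain i where "i < n" "x i \<noteq> 0 \<or> y i \<noteq> 0" using nz by blast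
    then show ?thesis by (intro sum_pos2[of _ i]) (auto simp: sum_power2_gt_zero_iff)
  qed
  ultimately show im: "Im a = 0" by simp
  have "(\<exists>i<n. x i \<noteq> 0) \<or> (\<exists>i<n. y i \<noteq> 0)" using nz by blast
  then show "0 \<le> Re a" "Re a \<le> spec_norm C"
    using psd_real_eigenpair_bounds[OF C psd, of x "Re a"] psd_real_eigenpair_bounds[OF C psd, of y "Re a"]
    by (auto simp: evx evy im)
qed

section \<open>Trace and determinant through the eigenvalues\<close>

lemma mat_trace_mult_commute:
  assumes A: "A \<in> carrier_mat n m" and B: "B \<in> carrier_mat m n"
  shows "mat_trace (A * B) = mat_trace (B * A)"
proof -
  have "mat_trace (A * B) = (\<Sum>i<n. \<Sum>k<m. A $$ (i, k) * B $$ (k, i))"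
    using A mult_mat_index_sum[OF A B] by (auto simp: mat_trace_def simp del: index_mult_mat(1) intro!: sum.cong)
  also have "\<dots> = (\<Sum>k<m. \<Sum>i<n. B $$ (k, i) * A $$ (i, k))"
    by (subst sum.swap) (simp add: mult.commute)
  also have "\<dots> = mat_trace (B * A)"
    using B mult_mat_index_sum[OF B A] by (auto simp: mat_trace_def simp del: index_mult_mat(1) intro!: sum.cong)
  finally show ?thesis .
qed

text \<open>The characteristic polynomial splits over the complex numbers with real roots, hence
  over the reals. A real Schur decomposition \<open>C = P * B * Q\<close> then reads trace and
  shifted determinants off the diagonal of \<open>B\<close>, with multiplicities.\<close>

lemma psd_spectrum:
  assumes C: "C \<in> carrier_mat n n"
    and sym: "\<And>i j. i < n \<Longrightarrow> j < n \<Longrightarrow> C $$ (i, j) = C $$ (j, i)"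
    and psd: "\<And>u. 0 \<le> (\<Sum>i<n. \<Sum>j<n. u i * u j * C $$ (i, j))"
  obtains es where "\<And>e. e \<in> set es \<Longrightarrow> 0 \<le> e \<and> e \<le> spec_norm C"
    "mat_trace C = sum_list es"
    "\<And>s. det (1\<^sub>m n + s \<cdot>\<^sub>m C) = (\<Prod>e\<leftarrow>es. 1 + s * e)"
proof -
  let ?C = "map_mat complex_of_real C"
  have cC: "?C \<in> carrier_mat n n" using C by simp
  obtain as where as: "char_poly ?C = (\<Prod>a\<leftarrow>as. [:- a, 1:])"
    using char_poly_factorized[OF cC] by blast
  have ev: "Im a = 0 \<and> 0 \<le> Re a \<and> Re a \<le> spec_norm C" if "a \<in> set as" for a
  proof -
    have "poly (char_poly ?C) a = 0"
      using that unfolding as poly_prod_list by (auto simp: prod_list_zero_iff)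
    then have "eigenvalue ?C a" using eigenvalue_root_char_poly[OF cC] by simp
    then show ?thesis using psd_complex_eigenvalue[OF C sym psd] by blast
  qed
  define es where "es = map Re as"
  have as_es: "as = map complex_of_real es"
    using ev by (auto simp: es_def o_def complex_eq_iff intro!: map_idI[symmetric])
  interpret mp: map_poly_inj_idom_hom complex_of_real ..
  \<comment> \<open>The real factorization is recovered because the embedding of real into complex
    polynomials is injective.\<close>
  have "map_poly complex_of_real (char_poly C) = map_poly complex_of_real (\<Prod>e\<leftarrow>es. [:- e, 1:])"
    unfolding of_real_hom.char_poly_hom[OF C, symmetric] as as_es
    by (simp add: mp.hom_prod_list o_def hom_distribs)
  then have cp: "char_poly C = (\<Prod>e\<leftarrow>es. [:- e, 1:])"
    by (rule mp.injectivity)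
  obtain B P Q where sd: "schur_decomposition C es = (B, P, Q)" by (metis prod_cases3)
  have sim: "similar_mat_wit C B P Q" and ut: "upper_triangular B" and dg: "diag_mat B = es"
    using schur_decomposition[OF C cp sd] by auto
  note w = similar_mat_witD2[OF C sim]
  have B: "B \<in> carrier_mat n n" and P: "P \<in> carrier_mat n n" and Q: "Q \<in> carrier_mat n n"
    and PQ: "P * Q = 1\<^sub>m n" and QP: "Q * P = 1\<^sub>m n" and CB: "C = P * B * Q"
    using w by auto
  have "mat_trace C = mat_trace (Q * (P * B))"
    unfolding CB using mat_trace_mult_commute[of "P * B" n n Q] P B Q by simp
  also have "Q * (P * B) = B"
    using P B Q QP by (simp flip: assoc_mult_mat[of Q n n P n B n])
  also have "mat_trace B = sum_list es"
    using B by (simp add: mat_trace_def flip: dg) (simp add: diag_mat_def sum_list_distinct_conv_sum_set lessThan_atLeast0)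
  finally have tr: "mat_trace C = sum_list es" .
  have dt: "det (1\<^sub>m n + s \<cdot>\<^sub>m C) = (\<Prod>e\<leftarrow>es. 1 + s * e)" for s
  proof -
    \<comment> \<open>The matrices that triangularize \<open>C\<close> also conjugate the shifted
      matrix to a triangular one.\<close>
    let ?B = "1\<^sub>m n + s \<cdot>\<^sub>m B"
    have B': "?B \<in> carrier_mat n n" using B by simp
    have "P * ?B * Q = (P + P * (s \<cdot>\<^sub>m B)) * Q"
      using P B by (simp add: mult_add_distrib_mat[of P n n "1\<^sub>m n" n])
    also have "\<dots> = P * Q + (P * (s \<cdot>\<^sub>m B)) * Q"
      using P B Q by (intro add_mult_distrib_mat) auto
    also have "\<dots> = 1\<^sub>m n + s \<cdot>\<^sub>m C"
      using P B Q by (simp add: PQ CB mult_smult_distrib[of P n n B n] mult_smult_assoc_mat[of "P * B" n n Q n])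
    finally have "similar_mat_wit (1\<^sub>m n + s \<cdot>\<^sub>m C) ?B P Q"
      using P B Q C PQ QP by (intro similar_mat_witI) auto
    then have "det (1\<^sub>m n + s \<cdot>\<^sub>m C) = det ?B"
      by (intro det_similar) (auto simp: similar_mat_def)
    also have "\<dots> = prod_list (diag_mat ?B)"
      using ut B by (intro det_upper_triangular[OF _ B']) (auto simp: upper_triangular_def)
    also have "diag_mat ?B = map (\<lambda>e. 1 + s * e) es"
      using B by (auto simp: diag_mat_def simp flip: dg)
    finally show ?thesis .
  qed
  show ?thesis using that[OF _ tr dt] ev by (auto simp: es_def)
qed

lemma ln_chord_le:
  fixes s b e :: real
  assumes "s > 0" "b > 0" "0 \<le> e" "e \<le> b"
  shows "e * ln (1 + s * b) \<le> b * ln (1 + s * e)"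
proof -
  let ?t = "e / b"
  have "(1 - ?t) * ln 1 + ?t * ln (1 + s * b) \<le> ln ((1 - ?t) * 1 + ?t * (1 + s * b))"
    using concave_onD[OF ln_concave, of ?t 1 "1 + s * b"] assms by (simp add: add_pos_pos)
  also have "(1 - ?t) * 1 + ?t * (1 + s * b) = 1 + s * e"
    using assms by (simp add: field_simps)
  finally show ?thesis using assms by (simp add: field_simps)
qed

lemma ln_prod_list:
  fixes f :: "'b \<Rightarrow> real"
  assumes "\<And>x. x \<in> set xs \<Longrightarrow> f x > 0"
  shows "(\<Prod>x\<leftarrow>xs. f x) > 0 \<and> ln (\<Prod>x\<leftarrow>xs. f x) = (\<Sum>x\<leftarrow>xs. ln (f x))"
  using assms
proof (induction xs)
  case (Cons a xs)
  then have "f a > 0" "(\<Prod>x\<leftarrow>xs. f x) > 0 \<and> ln (\<Prod>x\<leftarrow>xs. f x) = (\<Sum>x\<leftarrow>xs. ln (f x))" by auto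
  then show ?case by (simp add: ln_mult_pos)
qed simp

text \<open>Eigenvalue by eigenvalue: positivity of \<open>1 + s * e\<close>, the estimate
  \<open>ln (1 + x) \<le> x\<close>, and the chord inequality. The second bound makes the
  information gain finite; the third, with \<open>b\<close> above the spectral norm, controls traces
  by information.\<close>

lemma psd_ln_det_bounds:
  assumes C: "C \<in> carrier_mat n n"
    and sym: "\<And>i j. i < n \<Longrightarrow> j < n \<Longrightarrow> C $$ (i, j) = C $$ (j, i)"
    and psd: "\<And>u. 0 \<le> (\<Sum>i<n. \<Sum>j<n. u i * u j * C $$ (i, j))"
    and s: "s > 0"
  shows "det (1\<^sub>m n + s \<cdot>\<^sub>m C) > 0"
    and "ln (det (1\<^sub>m n + s \<cdot>\<^sub>m C)) \<le> s * mat_trace C"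
    and "\<And>b. b > 0 \<Longrightarrow> spec_norm C \<le> b \<Longrightarrow> mat_trace C * ln (1 + s * b) \<le> b * ln (det (1\<^sub>m n + s \<cdot>\<^sub>m C))"
proof -
  obtain es where es: "\<And>e. e \<in> set es \<Longrightarrow> 0 \<le> e \<and> e \<le> spec_norm C"
    and tr: "mat_trace C = sum_list es"
    and dt: "\<And>s. det (1\<^sub>m n + s \<cdot>\<^sub>m C) = (\<Prod>e\<leftarrow>es. 1 + s * e)"
    using psd_spectrum[OF C sym psd] by blast
  have pos: "1 + s * e > 0" if "e \<in> set es" for e using es[OF that] s by (simp add: add_pos_nonneg)
  show "det (1\<^sub>m n + s \<cdot>\<^sub>m C) > 0" using ln_prod_list[of es "\<lambda>e. 1 + s * e"] pos by (simp add: dt)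
  have ln: "ln (det (1\<^sub>m n + s \<cdot>\<^sub>m C)) = (\<Sum>e\<leftarrow>es. ln (1 + s * e))"
    using ln_prod_list[of es "\<lambda>e. 1 + s * e"] pos by (simp add: dt)
  have "(\<Sum>e\<leftarrow>es. ln (1 + s * e)) \<le> (\<Sum>e\<leftarrow>es. s * e)"
    using es s by (intro sum_list_mono ln_add_one_self_le_self) auto
  then show "ln (det (1\<^sub>m n + s \<cdot>\<^sub>m C)) \<le> s * mat_trace C"
    by (simp add: ln tr sum_list_const_mult)
  show "mat_trace C * ln (1 + s * b) \<le> b * ln (det (1\<^sub>m n + s \<cdot>\<^sub>m C))"
    if "b > 0" "spec_norm C \<le> b" for b
  proof -
    have "(\<Sum>e\<leftarrow>es. e * ln (1 + s * b)) \<le> (\<Sum>e\<leftarrow>es. b * ln (1 + s * e))"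
      using es s that by (intro sum_list_mono ln_chord_le) force+
    then show ?thesis by (simp add: ln tr sum_list_const_mult sum_list_mult_const)
  qed
qed

text \<open>Block elimination: multiplying on the right by a unit upper triangular block matrix with
  corner \<open>- (Ai * B)\<close> clears the upper right block and keeps the determinant.\<close>

lemma det_Schur_complement:
  fixes A B C D Ai :: "real mat"
  assumes A: "A \<in> carrier_mat n n" and B: "B \<in> carrier_mat n m"
    and C: "C \<in> carrier_mat m n" and D: "D \<in> carrier_mat m m"
    and Ai: "Ai \<in> carrier_mat n n" "A * Ai = 1\<^sub>m n"
  shows "det (four_block_mat A B C D) = det A * det (D - C * (Ai * B))"
proof -
  define E where "E = Ai * B"
  let ?M = "four_block_mat A B C D" and ?U = "four_block_mat (1\<^sub>m n) (- E) (0\<^sub>m m n) (1\<^sub>m m)"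
  have E: "E \<in> carrier_mat n m" using Ai B by (simp add: E_def)
  have AE: "A * E = B"
    unfolding E_def using assoc_mult_mat[OF A Ai(1) B] Ai(2) B by simp
  have z: "A * - E + B * 1\<^sub>m m = 0\<^sub>m n m"
    unfolding uminus_mult_right_mat[OF carrier_matD(2)[OF A, folded carrier_matD(1)[OF E]]] AE right_mult_one_mat[OF B]
    by (rule uminus_l_inv_mat[OF B])
  have CE: "C * E \<in> carrier_mat m m" using C E by simp
  have d: "C * - E + D * 1\<^sub>m m = D - C * E"
    unfolding uminus_mult_right_mat[OF carrier_matD(2)[OF C, folded carrier_matD(1)[OF E]]] right_mult_one_mat[OF D]
    unfolding minus_add_uminus_mat[OF D CE] by (rule comm_add_mat) (use CE D in auto)
  have "?M * ?U = four_block_mat (A * 1\<^sub>m n + B * 0\<^sub>m m n) (A * - E + B * 1\<^sub>m m)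
      (C * 1\<^sub>m n + D * 0\<^sub>m m n) (C * - E + D * 1\<^sub>m m)"
    by (rule mult_four_block_mat[OF A B C D]) (use E in auto)
  also have "\<dots> = four_block_mat A (0\<^sub>m n m) C (D - C * E)"
    unfolding z d using A B C D by simp
  finally have MU: "?M * ?U = four_block_mat A (0\<^sub>m n m) C (D - C * E)" .
  have "det ?M * det ?U = det (?M * ?U)"
    by (rule det_mult[symmetric, of _ "n + m"]) (use A B C D E in auto)
  also have "\<dots> = det A * det (D - C * E)"
    unfolding MU by (rule det_four_block_mat_upper_right_zero[OF A refl C minus_carrier_mat[OF CE]])
  finally have "det ?M * det ?U = det A * det (D - C * E)" .
  moreover have "det ?U = det (1\<^sub>m n) * det (1\<^sub>m m)"
    by (rule det_four_block_mat_lower_left_zero[OF _ _ refl]) (use E in auto)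
  ultimately show ?thesis by (simp add: E_def)
qed

section \<open>The Gaussian process posterior\<close>

lemma sum_lessThan_add: "(\<Sum>i<m + n. F i) = (\<Sum>i<m. F i) + (\<Sum>i<n. F (m + i :: nat) :: real)"
  by (induction n) (auto simp: add.assoc)

lemma kmat_carrier [simp]: "kmat k P Q \<in> carrier_mat (length P) (length Q)"
  by (simp add: kmat_def)

lemma kmat_index [simp]: "i < length P \<Longrightarrow> j < length Q \<Longrightarrow> kmat k P Q $$ (i, j) = k (P ! i) (Q ! j)"
  by (simp add: kmat_def)

lemma kmat_dim [simp]: "dim_row (kmat k P Q) = length P" "dim_col (kmat k P Q) = length Q"
  by (simp_all add: kmat_def)

lemma kmat_sym_psd:
  assumes K: "kernel_on X k" and P: "set P \<subseteq> X"
  shows "\<And>i j. i < length P \<Longrightarrow> j < length P \<Longrightarrow> kmat k P P $$ (i, j) = kmat k P P $$ (j, i)"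
    and "\<And>u. 0 \<le> (\<Sum>i<length P. \<Sum>j<length P. u i * u j * kmat k P P $$ (i, j))"
proof -
  have p: "P ! i \<in> X" if "i < length P" for i using that P by auto
  show "kmat k P P $$ (i, j) = kmat k P P $$ (j, i)" if "i < length P" "j < length P" for i j
    using K p that by (auto simp: kernel_on_def)
  show "0 \<le> (\<Sum>i<length P. \<Sum>j<length P. u i * u j * kmat k P P $$ (i, j))" for u
    using kernel_on_nonneg_indexed[of X k "length P" "(!) P" u, OF K p] by simp
qed

text \<open>Translates between the matrix that the posterior inverts and the one in the information
  gain.\<close>

lemma det_shift_eq:
  fixes M :: "real mat"
  assumes "M \<in> carrier_mat n n" "s \<noteq> 0"
  shows "det (s \<cdot>\<^sub>m 1\<^sub>m n + M) = s ^ n * det (1\<^sub>m n + (1 / s) \<cdot>\<^sub>m M)"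
proof -
  have "s \<cdot>\<^sub>m 1\<^sub>m n + M = s \<cdot>\<^sub>m (1\<^sub>m n + (1 / s) \<cdot>\<^sub>m M)"
    using assms by (intro eq_matI) (auto simp: field_simps)
  then show ?thesis using assms by simp
qed

locale gp_posterior =
  fixes X :: "'a set" and k :: "'a \<Rightarrow> 'a \<Rightarrow> real" and \<sigma> :: real and P :: "'a list"
  assumes K: "kernel_on X k" and \<sigma>: "\<sigma> > 0" and PX: "set P \<subseteq> X"
begin

abbreviation "m \<equiv> length P"

definition "A = \<sigma>\<^sup>2 \<cdot>\<^sub>m 1\<^sub>m m + kmat k P P"

text \<open>The weights of the posterior mean: at \<open>z\<close> it is the sum of
  \<open>w z j\<close> times the \<open>j\<close>-th observation.\<close>

definition "w z j = (mat_inv A *\<^sub>v vec m (\<lambda>i. k (P ! i) z)) $ j"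

text \<open>The posterior covariance function; \<open>post_cov\<close> is its Gram matrix.\<close>

definition "pk z z' = k z z' - (\<Sum>j<m. k (P ! j) z * w z' j)"

section \<open>The linear system of the regularized Gram matrix\<close>

lemma p_in [simp]: "i < m \<Longrightarrow> P ! i \<in> X"
  using PX by auto

lemma k_sym: "x \<in> X \<Longrightarrow> y \<in> X \<Longrightarrow> k x y = k y x"
  using K by (auto simp: kernel_on_def)

lemma A_carrier [simp]: "A \<in> carrier_mat m m"
  by (simp add: A_def)

lemma A_index: "i < m \<Longrightarrow> j < m \<Longrightarrow> A $$ (i, j) = k (P ! i) (P ! j) + (if i = j then \<sigma>\<^sup>2 else 0)"
  by (simp add: A_def)

text \<open>Semidefiniteness of the Gram matrix makes the determinant positive after rescaling by
  \<open>\<sigma>\<^sup>2\<close>. Hence the choice in \<open>mat_inv\<close> yields an actual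
  inverse.\<close>

lemma det_A_nonzero: "det A \<noteq> 0"
proof -
  have "det (1\<^sub>m m + (1 / \<sigma>\<^sup>2) \<cdot>\<^sub>m kmat k P P) > 0"
    using \<sigma> by (intro psd_ln_det_bounds(1) kmat_sym_psd[OF K PX]) auto
  then show ?thesis using \<sigma> by (simp add: A_def det_shift_eq)
qed

lemma mat_inv_A:
  "mat_inv A \<in> carrier_mat m m" "A * mat_inv A = 1\<^sub>m m" "mat_inv A * A = 1\<^sub>m m"
proof -
  have "A \<in> Units (ring_mat TYPE(real) m ())"
    by (rule det_non_zero_imp_unit[OF A_carrier det_A_nonzero])
  then have "\<exists>B. B \<in> carrier_mat (dim_row A) (dim_row A) \<and> A * B = 1\<^sub>m (dim_row A) \<and> B * A = 1\<^sub>m (dim_row A)"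
    by (auto simp: Units_def ring_mat_def A_def)
  from someI_ex[OF this]
  have "mat_inv A \<in> carrier_mat (dim_row A) (dim_row A) \<and> A * mat_inv A = 1\<^sub>m (dim_row A) \<and> mat_inv A * A = 1\<^sub>m (dim_row A)"
    unfolding mat_inv_def .
  then show "mat_inv A \<in> carrier_mat m m" "A * mat_inv A = 1\<^sub>m m" "mat_inv A * A = 1\<^sub>m m"
    by (auto simp: A_def)
qed

lemma A_mult_inv_vec:
  assumes "v \<in> carrier_vec m" "i < m"
  shows "(\<Sum>j<m. A $$ (i, j) * (mat_inv A *\<^sub>v v) $ j) = v $ i"
proof -
  have "A *\<^sub>v (mat_inv A *\<^sub>v v) = v"
    using assms mat_inv_A by (simp flip: assoc_mult_mat_vec[of A m m "mat_inv A" m])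
  then show ?thesis
    using mult_mat_vec_index_sum[OF A_carrier _ assms(2), of "mat_inv A *\<^sub>v v"] mat_inv_A(1) assms by simp
qed

text \<open>The weights solve a linear system with a symmetric matrix; together with
  \<open>A_self_adjoint\<close> this replaces most manipulation of the inverse.\<close>

lemma A_mult_w: "i < m \<Longrightarrow> (\<Sum>j<m. A $$ (i, j) * w z j) = k (P ! i) z"
  using A_mult_inv_vec[of "vec m (\<lambda>i. k (P ! i) z)" i] by (simp add: w_def)

lemma A_sum: "i < m \<Longrightarrow> (\<Sum>j<m. A $$ (i, j) * v j) = (\<Sum>j<m. k (P ! i) (P ! j) * v j) + \<sigma>\<^sup>2 * v i"
  by (simp add: A_index distrib_right sum.distrib if_distrib[of "\<lambda>z. z * _"] cong: if_cong)

lemma A_self_adjoint: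
  "(\<Sum>i<m. (\<Sum>j<m. A $$ (i, j) * u j) * v i) = (\<Sum>i<m. u i * (\<Sum>j<m. A $$ (i, j) * v j))"
proof -
  have s: "A $$ (i, j) = A $$ (j, i)" if "i < m" "j < m" for i j
    using that by (auto simp: A_index k_sym)
  have "(\<Sum>i<m. (\<Sum>j<m. A $$ (i, j) * u j) * v i) = (\<Sum>i<m. \<Sum>j<m. u j * (A $$ (j, i) * v i))"
    unfolding sum_distrib_right by (intro sum.cong refl) (auto simp: s mult_ac)
  also have "\<dots> = (\<Sum>j<m. u j * (\<Sum>i<m. A $$ (j, i) * v i))"
    by (subst sum.swap) (simp add: sum_distrib_left)
  finally show ?thesis .
qed

lemma A_form: "(\<Sum>i<m. v i * (\<Sum>j<m. A $$ (i, j) * v j))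
    = (\<Sum>i<m. \<Sum>j<m. v i * v j * k (P ! i) (P ! j)) + \<sigma>\<^sup>2 * (\<Sum>i<m. (v i)\<^sup>2)"
proof -
  have "(\<Sum>i<m. v i * (\<Sum>j<m. A $$ (i, j) * v j))
      = (\<Sum>i<m. (\<Sum>j<m. v i * v j * k (P ! i) (P ! j)) + \<sigma>\<^sup>2 * (v i)\<^sup>2)"
    by (intro sum.cong) (auto simp: A_sum, simp add: distrib_left sum_distrib_left power2_eq_square mult_ac)
  then show ?thesis by (simp add: sum.distrib sum_distrib_left)
qed

text \<open>Symmetry of \<open>A\<close> moves the inverse from the observations to the kernel
  vector at \<open>z\<close>.\<close>

lemma post_mean_eq:
  assumes z: "z \<in> X" and ys: "length ys = m"
  shows "post_mean k \<sigma> P ys z = (\<Sum>j<m. w z j * ys ! j)"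
proof -
  let ?y = "vec m (\<lambda>i. ys ! i)"
  have A': "kmat k P P + \<sigma>\<^sup>2 \<cdot>\<^sub>m 1\<^sub>m m = A"
    unfolding A_def by (rule comm_add_mat[of _ m m]) auto
  have "post_mean k \<sigma> P ys z = (\<Sum>i<m. k z (P ! i) * (mat_inv A *\<^sub>v ?y) $ i)"
    unfolding post_mean_def A' using mat_inv_A(1)
    by (auto simp: scalar_prod_def lessThan_atLeast0 simp del: index_mult_mat_vec intro!: sum.cong)
  also have "\<dots> = (\<Sum>i<m. (\<Sum>j<m. A $$ (i, j) * w z j) * (mat_inv A *\<^sub>v ?y) $ i)"
    using z by (intro sum.cong refl) (simp add: A_mult_w k_sym del: index_mult_mat_vec)
  also have "\<dots> = (\<Sum>j<m. w z j * ys ! j)"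
    unfolding A_self_adjoint by (intro sum.cong refl) (simp add: A_mult_inv_vec del: index_mult_mat_vec)
  finally show ?thesis .
qed

lemma post_cov_eq: "post_cov k \<sigma> P Z = kmat pk Z Z"
proof (rule eq_matI)
  have inv: "mat_inv A \<in> carrier_mat m m" by (rule mat_inv_A)
  have PZ: "mat_inv A * kmat k P Z \<in> carrier_mat m (length Z)" using inv by simp
  have T: "transpose_mat (kmat k P Z) \<in> carrier_mat (length Z) m" by simp
  fix i j assume "i < dim_row (kmat pk Z Z)" "j < dim_col (kmat pk Z Z)"
  then have ij: "i < length Z" "j < length Z" by auto
  have col: "(mat_inv A * kmat k P Z) $$ (l, j) = w (Z ! j) l" if "l < m" for l
  proof -
    have "vec m (\<lambda>i. k (P ! i) (Z ! j)) = col (kmat k P Z) j" using ij by (intro eq_vecI) auto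
    then show ?thesis using inv ij that by (simp add: w_def)
  qed
  have "(transpose_mat (kmat k P Z) * (mat_inv A * kmat k P Z)) $$ (i, j)
      = (\<Sum>l<m. k (P ! l) (Z ! i) * w (Z ! j) l)"
    unfolding mult_mat_index_sum[OF T PZ ij] using ij by (intro sum.cong refl) (simp add: col del: index_mult_mat)
  then show "post_cov k \<sigma> P Z $$ (i, j) = kmat pk Z Z $$ (i, j)"
    using ij inv by (simp add: post_cov_def pk_def flip: A_def del: index_mult_mat(1))
qed (auto simp: post_cov_def simp flip: A_def)

text \<open>The subtracted term is the symmetric bilinear form of \<open>A\<close> at the two weight
  vectors.\<close>

lemma pk_sym: "x \<in> X \<Longrightarrow> y \<in> X \<Longrightarrow> pk x y = pk y x"
proof -
  assume "x \<in> X" "y \<in> X"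
  have "(\<Sum>j<m. k (P ! j) x * w y j) = (\<Sum>j<m. (\<Sum>l<m. A $$ (j, l) * w x l) * w y j)"
    by (simp add: A_mult_w)
  also have "\<dots> = (\<Sum>j<m. k (P ! j) y * w x j)"
    unfolding A_self_adjoint by (intro sum.cong refl) (subst A_mult_w, simp, rule mult.commute)
  finally show ?thesis using k_sym[OF \<open>x \<in> X\<close> \<open>y \<in> X\<close>] by (simp add: pk_def)
qed

text \<open>Needed when the maximizer of \<open>f\<close> has already been queried: the cross term that \<open>\<sigma>\<^sup>2 \<delta>\<close> then
  contributes to the error is \<open>- 2 \<sigma>\<^sup>2 w z j\<close>, so it may be dropped.\<close>
lemma weight_at_data_nonneg:
  assumes j: "j < m"
  shows "w (P ! j) j \<ge> 0"
proof -
  \<comment> \<open>\<open>A\<close> maps \<open>d\<close> to \<open>\<sigma>\<^sup>2\<close> times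
    the \<open>j\<close>-th unit vector. So the \<open>A\<close>-form of \<open>d\<close> is
    \<open>\<sigma>\<^sup>2 * d j\<close>, and it is at least
    \<open>\<sigma>\<^sup>2 * (d j)\<^sup>2\<close>, which gives \<open>d j \<le> 1\<close>.\<close>
  define d where "d i = (if i = j then 1 else 0) - w (P ! j) i" for i
  have Ad: "(\<Sum>l<m. A $$ (i, l) * d l) = (if i = j then \<sigma>\<^sup>2 else 0)" if "i < m" for i
  proof -
    have "(\<Sum>l<m. A $$ (i, l) * d l) = (\<Sum>l<m. if l = j then A $$ (i, l) else 0) - (\<Sum>l<m. A $$ (i, l) * w (P ! j) l)"
      unfolding sum_subtractf[symmetric] by (intro sum.cong) (auto simp: d_def algebra_simps)
    then show ?thesis unfolding A_mult_w[OF that] using that j by (simp add: A_index)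
  qed
  have "(\<Sum>i<m. d i * (\<Sum>l<m. A $$ (i, l) * d l)) = (\<Sum>i<m. if i = j then d i * \<sigma>\<^sup>2 else 0)"
    by (intro sum.cong) (auto simp: Ad)
  then have "(\<Sum>i<m. \<Sum>l<m. d i * d l * k (P ! i) (P ! l)) + \<sigma>\<^sup>2 * (\<Sum>i<m. (d i)\<^sup>2) = d j * \<sigma>\<^sup>2"
    using j unfolding A_form by simp
  moreover have "(\<Sum>i<m. \<Sum>l<m. d i * d l * k (P ! i) (P ! l)) \<ge> 0"
    by (rule kernel_on_nonneg_indexed[OF K]) auto
  moreover have "(d j)\<^sup>2 \<le> (\<Sum>i<m. (d i)\<^sup>2)" using j by (intro member_le_sum) auto
  then have "\<sigma>\<^sup>2 * (d j)\<^sup>2 \<le> \<sigma>\<^sup>2 * (\<Sum>i<m. (d i)\<^sup>2)" by (intro mult_left_mono) auto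
  ultimately have "\<sigma>\<^sup>2 * (d j)\<^sup>2 \<le> \<sigma>\<^sup>2 * d j" by (simp add: mult.commute)
  then have "d j * d j \<le> d j" using \<sigma> by (simp add: power2_eq_square)
  then have "d j \<le> 1" by (rule_tac ccontr) (use mult_strict_right_mono[of 1 "d j" "d j"] in auto)
  then show ?thesis by (simp add: d_def)
qed

section \<open>Errors of the posterior mean as combinations of point evaluations\<close>

context
  fixes z :: "nat \<Rightarrow> 'a" and u :: "nat \<Rightarrow> real" and n :: nat
  assumes z: "\<And>i. i < n \<Longrightarrow> z i \<in> X"
begin

text \<open>Total weight that the combination of posterior means with coefficients \<open>u\<close>
  puts on the \<open>j\<close>-th observation.\<close>

definition "W j = (\<Sum>i<n. u i * w (z i) j)"
definition "pt i = (if i < m then P ! i else z (i - m))"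
text \<open>Coefficients, data points first, that express the combined error of the posterior mean
  as one combination of values of \<open>h\<close> at the points \<open>pt i\<close>.\<close>

definition "cf i = (if i < m then - W i else u (i - m))"

lemma pt_in: "i < m + n \<Longrightarrow> pt i \<in> X"
  using z by (auto simp: pt_def)

text \<open>Plain bilinear expansion, kept for a general symmetric \<open>H\<close> because it
  serves both \<open>k\<close> and \<open>dirac\<close>.\<close>

lemma joint_form:
  assumes sym: "\<And>x y. x \<in> X \<Longrightarrow> y \<in> X \<Longrightarrow> H x y = H y x"
  shows "(\<Sum>i<m + n. \<Sum>j<m + n. cf i * cf j * H (pt i) (pt j))
    = (\<Sum>i<m. \<Sum>j<m. W i * W j * H (P ! i) (P ! j))
      - 2 * (\<Sum>j<m. W j * (\<Sum>i<n. u i * H (P ! j) (z i)))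
      + (\<Sum>i<n. \<Sum>j<n. u i * u j * H (z i) (z j))"
proof -
  have "(\<Sum>i<n. \<Sum>j<m. u i * W j * H (z i) (P ! j)) = (\<Sum>j<m. W j * (\<Sum>i<n. u i * H (P ! j) (z i)))"
    by (subst sum.swap) (auto simp: sum_distrib_left mult_ac sym z intro!: sum.cong)
  moreover have "(\<Sum>j<m. \<Sum>i<n. W j * u i * H (P ! j) (z i)) = (\<Sum>j<m. W j * (\<Sum>i<n. u i * H (P ! j) (z i)))"
    by (simp add: sum_distrib_left mult_ac)
  moreover have "(\<Sum>i<m + n. \<Sum>j<m + n. cf i * cf j * H (pt i) (pt j))
    = (\<Sum>i<m. \<Sum>j<m. W i * W j * H (P ! i) (P ! j)) - (\<Sum>j<m. \<Sum>i<n. W j * u i * H (P ! j) (z i))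
      - (\<Sum>i<n. \<Sum>j<m. u i * W j * H (z i) (P ! j)) + (\<Sum>i<n. \<Sum>j<n. u i * u j * H (z i) (z j))"
    by (simp add: sum_lessThan_add cf_def pt_def sum.distrib sum_negf sum_subtractf)
  ultimately show ?thesis by simp
qed

lemma A_mult_W: "j < m \<Longrightarrow> (\<Sum>l<m. A $$ (j, l) * W l) = (\<Sum>i<n. u i * k (P ! j) (z i))"
proof -
  assume j: "j < m"
  have "(\<Sum>l<m. A $$ (j, l) * W l) = (\<Sum>l<m. \<Sum>i<n. u i * (A $$ (j, l) * w (z i) l))"
    by (simp add: W_def sum_distrib_left mult_ac)
  also have "\<dots> = (\<Sum>i<n. u i * (\<Sum>l<m. A $$ (j, l) * w (z i) l))"
    by (subst sum.swap) (simp add: sum_distrib_left)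
  finally show ?thesis by (simp add: A_mult_w j)
qed

text \<open>By \<open>A_mult_W\<close> the cross term is the \<open>A\<close>-form of
  \<open>W\<close>, that is, its \<open>k\<close>-form plus \<open>\<sigma>\<^sup>2\<close> times
  its squared length. So the posterior variance already accounts for the noise on the data.\<close>

lemma pk_form:
  "(\<Sum>i<n. \<Sum>j<n. u i * u j * pk (z i) (z j))
    = (\<Sum>i<m + n. \<Sum>j<m + n. cf i * cf j * k (pt i) (pt j)) + \<sigma>\<^sup>2 * (\<Sum>j<m. (W j)\<^sup>2)"
proof -
  have "(\<Sum>i<n. \<Sum>j<n. u i * u j * (\<Sum>l<m. k (P ! l) (z i) * w (z j) l))
      = (\<Sum>i<n. \<Sum>j<n. \<Sum>l<m. u i * k (P ! l) (z i) * (u j * w (z j) l))"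
    by (simp add: sum_distrib_left mult_ac)
  also have "\<dots> = (\<Sum>i<n. \<Sum>l<m. \<Sum>j<n. u i * k (P ! l) (z i) * (u j * w (z j) l))"
    by (intro sum.cong refl sum.swap)
  also have "\<dots> = (\<Sum>l<m. \<Sum>i<n. \<Sum>j<n. u i * k (P ! l) (z i) * (u j * w (z j) l))"
    by (rule sum.swap)
  also have "\<dots> = (\<Sum>l<m. (\<Sum>i<n. u i * k (P ! l) (z i)) * W l)"
    by (simp only: W_def sum_product)
  also have "\<dots> = (\<Sum>l<m. W l * (\<Sum>i<n. u i * k (P ! l) (z i)))"
    by (intro sum.cong refl mult.commute)
  finally have c: "(\<Sum>i<n. \<Sum>j<n. u i * u j * (\<Sum>l<m. k (P ! l) (z i) * w (z j) l))
      = (\<Sum>l<m. W l * (\<Sum>i<n. u i * k (P ! l) (z i)))" .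
  have "(\<Sum>l<m. W l * (\<Sum>i<n. u i * k (P ! l) (z i)))
      = (\<Sum>i<m. \<Sum>j<m. W i * W j * k (P ! i) (P ! j)) + \<sigma>\<^sup>2 * (\<Sum>i<m. (W i)\<^sup>2)"
    unfolding A_form[symmetric] by (intro sum.cong refl) (simp add: A_mult_W)
  moreover have "(\<Sum>i<n. \<Sum>j<n. u i * u j * pk (z i) (z j))
     = (\<Sum>i<n. \<Sum>j<n. u i * u j * k (z i) (z j)) - (\<Sum>l<m. W l * (\<Sum>i<n. u i * k (P ! l) (z i)))"
    unfolding c[symmetric] by (simp add: pk_def right_diff_distrib sum_subtractf)
  ultimately show ?thesis
    using joint_form[of k] k_sym by force
qed

lemma pk_form_nonneg: "(\<Sum>i<n. \<Sum>j<n. u i * u j * pk (z i) (z j)) \<ge> 0"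
  unfolding pk_form
  by (intro add_nonneg_nonneg kernel_on_nonneg_indexed[OF K] mult_nonneg_nonneg sum_nonneg pt_in) auto

text \<open>The error is a combination of values of \<open>h\<close>, so the norm inequality for
  \<open>k\<sigma>\<close> applies. Its form is the posterior form plus
  \<open>\<sigma>\<^sup>2\<close> times the Dirac contribution of the new points: their own form
  minus twice the overlap with the data. \<open>D\<close> bounds this contribution.\<close>

lemma posterior_error_bound:
  fixes h :: "'a \<Rightarrow> real"
  defines "k\<sigma> \<equiv> \<lambda>x y. k x y + \<sigma>\<^sup>2 * dirac x y"
  assumes h: "rkhs_mem k\<sigma> X h" and dP: "distinct P"
    and D: "(\<Sum>i<n. \<Sum>j<n. u i * u j * dirac (z i) (z j)) - 2 * (\<Sum>j<m. W j * (\<Sum>i<n. u i * dirac (P ! j) (z i))) \<le> D"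
    and "D \<ge> 0"
  shows "\<bar>\<Sum>i<n. u i * (h (z i) - post_mean k \<sigma> P (map h P) (z i))\<bar>
    \<le> rkhs_norm k\<sigma> X h * (sqrt (\<Sum>i<n. \<Sum>j<n. u i * u j * pk (z i) (z j)) + \<sigma> * sqrt D)"
proof -
  have K\<sigma>: "kernel_on X k\<sigma>" unfolding k\<sigma>_def by (intro kernel_on_add K kernel_on_dirac) auto
  let ?pk = "\<Sum>i<n. \<Sum>j<n. u i * u j * pk (z i) (z j)"
  have ds: "dirac x y = dirac y x" for x y :: 'a by (auto simp: dirac_def)
  have dPW: "(\<Sum>i<m. \<Sum>j<m. W i * W j * dirac (P ! i) (P ! j)) = (\<Sum>j<m. (W j)\<^sup>2)"
  proof (intro sum.cong refl)
    fix i assume "i \<in> {..<m}"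
    then have "(\<Sum>j<m. W i * W j * dirac (P ! i) (P ! j)) = (\<Sum>j<m. if j = i then W i * W j else 0)"
      using dP by (intro sum.cong) (auto simp: dirac_def nth_eq_iff_index_eq)
    then show "(\<Sum>j<m. W i * W j * dirac (P ! i) (P ! j)) = (W i)\<^sup>2"
      using \<open>i \<in> {..<m}\<close> by (simp add: power2_eq_square)
  qed
  have "(\<Sum>i<m + n. \<Sum>j<m + n. cf i * cf j * k\<sigma> (pt i) (pt j))
      = (\<Sum>i<m + n. \<Sum>j<m + n. cf i * cf j * k (pt i) (pt j))
        + \<sigma>\<^sup>2 * (\<Sum>i<m + n. \<Sum>j<m + n. cf i * cf j * dirac (pt i) (pt j))"
    unfolding k\<sigma>_def sum_distrib_left sum.distrib[symmetric]
    by (intro sum.cong refl) (simp add: algebra_simps)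
  also have "\<dots> = ?pk + \<sigma>\<^sup>2 * ((\<Sum>i<n. \<Sum>j<n. u i * u j * dirac (z i) (z j))
      - 2 * (\<Sum>j<m. W j * (\<Sum>i<n. u i * dirac (P ! j) (z i))))"
    unfolding pk_form joint_form[of dirac, OF ds] dPW by (simp add: algebra_simps)
  also have "\<dots> \<le> ?pk + \<sigma>\<^sup>2 * D" using D by (intro add_left_mono mult_left_mono) auto
  finally have q: "(\<Sum>i<m + n. \<Sum>j<m + n. cf i * cf j * k\<sigma> (pt i) (pt j)) \<le> ?pk + \<sigma>\<^sup>2 * D" .
  have "(\<Sum>i<n. u i * (h (z i) - post_mean k \<sigma> P (map h P) (z i)))
      = (\<Sum>i<n. u i * h (z i)) - (\<Sum>i<n. \<Sum>j<m. u i * w (z i) j * h (P ! j))"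
    by (simp add: post_mean_eq z right_diff_distrib sum_subtractf sum_distrib_left mult.assoc)
  also have "(\<Sum>i<n. \<Sum>j<m. u i * w (z i) j * h (P ! j)) = (\<Sum>j<m. W j * h (P ! j))"
    by (subst sum.swap) (simp add: W_def sum_distrib_right)
  also have "(\<Sum>i<n. u i * h (z i)) - (\<Sum>j<m. W j * h (P ! j)) = (\<Sum>i<m + n. cf i * h (pt i))"
    by (simp add: sum_lessThan_add cf_def pt_def sum_negf)
  finally have "\<bar>\<Sum>i<n. u i * (h (z i) - post_mean k \<sigma> P (map h P) (z i))\<bar>
      \<le> rkhs_norm k\<sigma> X h * sqrt (\<Sum>i<m + n. \<Sum>j<m + n. cf i * cf j * k\<sigma> (pt i) (pt j))"
    using rkhs_norm_bound_indexed[of X k\<sigma> h "m + n" pt cf, OF K\<sigma> h pt_in] by simp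
  also have "\<dots> \<le> rkhs_norm k\<sigma> X h * sqrt (?pk + \<sigma>\<^sup>2 * D)"
    using q by (intro mult_left_mono rkhs_norm_nonneg[OF K\<sigma> h]) simp
  also have "\<dots> \<le> rkhs_norm k\<sigma> X h * (sqrt ?pk + \<sigma> * sqrt D)"
  proof (intro mult_left_mono rkhs_norm_nonneg[OF K\<sigma> h])
    have "sqrt (?pk + \<sigma>\<^sup>2 * D) \<le> sqrt ?pk + sqrt (\<sigma>\<^sup>2 * D)"
      using \<open>D \<ge> 0\<close> by (intro sqrt_add_le_add_sqrt pk_form_nonneg) simp
    then show "sqrt (?pk + \<sigma>\<^sup>2 * D) \<le> sqrt ?pk + \<sigma> * sqrt D" using \<sigma> by (simp add: real_sqrt_mult)
  qed
  finally show ?thesis .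
qed

end

section \<open>Consequences for single points and for batches\<close>

lemma post_cov_sym_psd:
  assumes Z: "set Z \<subseteq> X"
  shows "post_cov k \<sigma> P Z \<in> carrier_mat (length Z) (length Z)"
    and "\<And>i j. i < length Z \<Longrightarrow> j < length Z \<Longrightarrow> post_cov k \<sigma> P Z $$ (i, j) = post_cov k \<sigma> P Z $$ (j, i)"
    and "\<And>u. 0 \<le> (\<Sum>i<length Z. \<Sum>j<length Z. u i * u j * post_cov k \<sigma> P Z $$ (i, j))"
proof -
  have z: "Z ! i \<in> X" if "i < length Z" for i using that Z by auto
  show "post_cov k \<sigma> P Z \<in> carrier_mat (length Z) (length Z)" by (simp add: post_cov_eq)
  show "post_cov k \<sigma> P Z $$ (i, j) = post_cov k \<sigma> P Z $$ (j, i)" if "i < length Z" "j < length Z" for i j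
    using that by (simp add: post_cov_eq pk_sym z)
  show "0 \<le> (\<Sum>i<length Z. \<Sum>j<length Z. u i * u j * post_cov k \<sigma> P Z $$ (i, j))" for u
    using pk_form_nonneg[of "length Z" "\<lambda>i. Z ! i" u] z by (simp add: post_cov_eq)
qed

text \<open>The point may be a data point. The overlap term is subtracted and is nonnegative by
  \<open>weight_at_data_nonneg\<close>, so \<open>D = 1\<close> suffices.\<close>

lemma posterior_error_point:
  fixes h :: "'a \<Rightarrow> real"
  defines "k\<sigma> \<equiv> \<lambda>x y. k x y + \<sigma>\<^sup>2 * dirac x y"
  assumes h: "rkhs_mem k\<sigma> X h" and dP: "distinct P" and x: "x \<in> X"
  shows "\<bar>h x - post_mean k \<sigma> P (map h P) x\<bar> \<le> rkhs_norm k\<sigma> X h * (sqrt (pk x x) + \<sigma>)"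
proof -
  have "0 \<le> (\<Sum>j<m. W (\<lambda>_. x) (\<lambda>_. 1) 1 j * dirac (P ! j) x)"
    using weight_at_data_nonneg by (intro sum_nonneg) (auto simp: W_def dirac_def)
  then show ?thesis
    using posterior_error_bound[of 1 "\<lambda>_. x" h "\<lambda>_. 1" 1] h dP x
    by (simp add: k\<sigma>_def dirac_def)
qed

text \<open>Uniform weights: fresh points have no overlap with the data, and distinct points give
  the Dirac form \<open>1 / length Z\<close>, estimated by 1.\<close>

lemma posterior_error_batch:
  fixes h :: "'a \<Rightarrow> real"
  defines "k\<sigma> \<equiv> \<lambda>x y. k x y + \<sigma>\<^sup>2 * dirac x y"
  assumes h: "rkhs_mem k\<sigma> X h" and dPZ: "distinct (P @ Z)" and Z: "set Z \<subseteq> X" "Z \<noteq> []"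
  shows "\<bar>(\<Sum>i<length Z. h (Z ! i) - post_mean k \<sigma> P (map h P) (Z ! i)) / length Z\<bar>
    \<le> rkhs_norm k\<sigma> X h * (sqrt (mat_sum_all (post_cov k \<sigma> P Z) / (length Z)\<^sup>2) + \<sigma>)"
proof -
  let ?n = "length Z" and ?u = "\<lambda>_::nat. 1 / real (length Z)"
  have n: "real ?n \<ge> 1" using Z(2) by (cases Z) auto
  have z: "Z ! i \<in> X" if "i < ?n" for i using that Z by auto
  have "(\<Sum>i<?n. \<Sum>j<?n. ?u i * ?u j * dirac (Z ! i) (Z ! j)) = (\<Sum>i<?n. \<Sum>j<?n. if j = i then ?u i * ?u j else 0)"
    using dPZ by (intro sum.cong refl) (auto simp: dirac_def nth_eq_iff_index_eq)
  also have "\<dots> \<le> 1" using n by (simp add: field_simps)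
  finally have d1: "(\<Sum>i<?n. \<Sum>j<?n. ?u i * ?u j * dirac (Z ! i) (Z ! j)) \<le> 1" .
  have d0: "dirac (P ! j) (Z ! i) = 0" if "j < m" "i < ?n" for i j
    using dPZ nth_mem[OF that(1)] nth_mem[OF that(2)] by (auto simp: dirac_def)
  have "(\<Sum>j<m. W ((!) Z) ?u ?n j * (\<Sum>i<?n. ?u i * dirac (P ! j) (Z ! i))) = 0"
    by (intro sum.neutral) (auto simp: d0)
  then have "\<bar>\<Sum>i<?n. ?u i * (h (Z ! i) - post_mean k \<sigma> P (map h P) (Z ! i))\<bar>
    \<le> rkhs_norm k\<sigma> X h * (sqrt (\<Sum>i<?n. \<Sum>j<?n. ?u i * ?u j * pk (Z ! i) (Z ! j)) + \<sigma>)"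
    using posterior_error_bound[of ?n "(!) Z" h ?u 1] h dPZ z d1 unfolding k\<sigma>_def by auto
  moreover have "(\<Sum>i<?n. \<Sum>j<?n. ?u i * ?u j * pk (Z ! i) (Z ! j)) = mat_sum_all (post_cov k \<sigma> P Z) / (?n)\<^sup>2"
    by (simp add: post_cov_eq mat_sum_all_def sum_divide_distrib power2_eq_square)
  ultimately show ?thesis by (simp add: sum_divide_distrib)
qed

text \<open>With \<open>A\<close> as leading block, the Schur complement of the joint regularized
  Gram matrix is \<open>\<sigma>\<^sup>2\<close> times the identity plus the posterior covariance;
  the powers of \<open>\<sigma>\<^sup>2\<close> cancel. In logarithms this is the chain rule for
  information.\<close>

lemma det_append:
  assumes Z: "set Z \<subseteq> X"
  shows "det (1\<^sub>m (m + length Z) + (1 / \<sigma>\<^sup>2) \<cdot>\<^sub>m kmat k (P @ Z) (P @ Z))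
    = det (1\<^sub>m m + (1 / \<sigma>\<^sup>2) \<cdot>\<^sub>m kmat k P P) * det (1\<^sub>m (length Z) + (1 / \<sigma>\<^sup>2) \<cdot>\<^sub>m post_cov k \<sigma> P Z)"
proof -
  let ?n = "length Z"
  have z: "Z ! i \<in> X" if "i < ?n" for i using that Z by auto
  let ?KZP = "transpose_mat (kmat k P Z)" and ?D = "\<sigma>\<^sup>2 \<cdot>\<^sub>m 1\<^sub>m ?n + kmat k Z Z"
  have M: "\<sigma>\<^sup>2 \<cdot>\<^sub>m 1\<^sub>m (m + ?n) + kmat k (P @ Z) (P @ Z) = four_block_mat A (kmat k P Z) ?KZP ?D"
    by (intro eq_matI) (auto simp: A_def nth_append k_sym z)
  have D: "?D - ?KZP * (mat_inv A * kmat k P Z) = \<sigma>\<^sup>2 \<cdot>\<^sub>m 1\<^sub>m ?n + post_cov k \<sigma> P Z"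
    using mat_inv_A(1) unfolding post_cov_def A_def[symmetric]
    by (intro eq_matI) (auto simp del: index_mult_mat(1))
  have "det (four_block_mat A (kmat k P Z) ?KZP ?D) = det A * det (?D - ?KZP * (mat_inv A * kmat k P Z))"
    by (rule det_Schur_complement) (use mat_inv_A in auto)
  then have "det (\<sigma>\<^sup>2 \<cdot>\<^sub>m 1\<^sub>m (m + ?n) + kmat k (P @ Z) (P @ Z)) = det A * det (\<sigma>\<^sup>2 \<cdot>\<^sub>m 1\<^sub>m ?n + post_cov k \<sigma> P Z)"
    unfolding M D .
  moreover have "kmat k (P @ Z) (P @ Z) \<in> carrier_mat (m + ?n) (m + ?n)"
    using kmat_carrier[of k "P @ Z" "P @ Z"] by simp
  ultimately show ?thesis
    using \<sigma> post_cov_sym_psd(1)[OF Z] by (simp add: A_def det_shift_eq power_add)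
qed

end

section \<open>Regret\<close>

context gp_posterior
begin

text \<open>For copies of \<open>x\<close>, normalized trace and normalized sum of entries are both
  \<open>pk x x\<close>, so the acquisition value is an upper confidence bound for
  \<open>h x\<close> up to \<open>hn * \<sigma>\<close>. For \<open>Z\<close>, the subtracted square
  root cancels against the error of the averaged mean, leaving twice the trace term.\<close>

lemma batch_regret:
  fixes h :: "'a \<Rightarrow> real"
  defines "k\<sigma> \<equiv> \<lambda>x y. k x y + \<sigma>\<^sup>2 * dirac x y"
  defines "hn \<equiv> rkhs_norm k\<sigma> X h"
  defines "val \<equiv> \<lambda>Z. (1 / real (length Z)) * (\<Sum>i<length Z. post_mean k \<sigma> P (map h P) (Z ! i))
       + hn * (2 * sqrt (mat_trace (post_cov k \<sigma> P Z) / real (length Z))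
               - sqrt (mat_sum_all (post_cov k \<sigma> P Z) / (real (length Z))\<^sup>2))"
  assumes h: "rkhs_mem k\<sigma> X h" and dPZ: "distinct (P @ Z)" and Z: "set Z \<subseteq> X" "Z \<noteq> []" and x: "x \<in> X"
    and best: "val (replicate (length Z) x) \<le> val Z"
  shows "h x - (\<Sum>i<length Z. h (Z ! i)) / length Z
    \<le> 2 * hn * sqrt (mat_trace (post_cov k \<sigma> P Z) / length Z) + 2 * hn * \<sigma>"
proof -
  let ?n = "real (length Z)"
  let ?mean = "post_mean k \<sigma> P (map h P)"
  have n: "?n > 0" using Z(2) by simp
  let ?R = "replicate (length Z) x"
  have "mat_trace (post_cov k \<sigma> P ?R) = ?n * pk x x"
    by (simp add: post_cov_eq mat_trace_def)
  moreover have "mat_sum_all (post_cov k \<sigma> P ?R) = ?n * (?n * pk x x)"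
    by (simp add: post_cov_eq mat_sum_all_def)
  moreover have "(\<Sum>i<length Z. ?mean (?R ! i)) = ?n * ?mean x" by simp
  ultimately have "val ?R = ?mean x + hn * sqrt (pk x x)"
    using n by (simp add: val_def power2_eq_square)
  moreover have "h x - ?mean x \<le> hn * (sqrt (pk x x) + \<sigma>)"
    using posterior_error_point[of h x] h dPZ x by (simp add: hn_def k\<sigma>_def abs_le_iff)
  moreover have "(\<Sum>i<length Z. ?mean (Z ! i)) / ?n - (\<Sum>i<length Z. h (Z ! i)) / ?n
      \<le> hn * (sqrt (mat_sum_all (post_cov k \<sigma> P Z) / ?n\<^sup>2) + \<sigma>)"
    using posterior_error_batch[of h Z] h dPZ Z
    by (simp add: hn_def k\<sigma>_def abs_le_iff sum_subtractf diff_divide_distrib)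
  moreover have "val Z = (\<Sum>i<length Z. ?mean (Z ! i)) / ?n
      + hn * (2 * sqrt (mat_trace (post_cov k \<sigma> P Z) / ?n) - sqrt (mat_sum_all (post_cov k \<sigma> P Z) / ?n\<^sup>2))"
    by (simp add: val_def)
  ultimately show ?thesis using best by (simp add: algebra_simps)
qed

end

section \<open>Rounds, batches and information gain\<close>

lemma length_first_pts [simp]: "length (first_pts xs t) = t"
  by (simp add: first_pts_def)

lemma length_batch [simp]: "n \<ge> 1 \<Longrightarrow> length (batch xs L n) = L"
  by (cases n) (auto simp: batch_def)

lemma batch_nth: "n \<ge> 1 \<Longrightarrow> i < L \<Longrightarrow> batch xs L n ! i = xs ((n - 1) * L + 1 + i)"
  by (cases n) (auto simp: batch_def simp del: upt_Suc)

lemma first_pts_append_batch: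
  assumes "n \<ge> 1"
  shows "first_pts xs ((n - 1) * L) @ batch xs L n = first_pts xs (n * L)"
proof -
  have "[1..<n * L + 1] = [1..<(n - 1) * L + 1] @ [(n - 1) * L + 1..<n * L + 1]"
    using assms upt_add_eq_append[of 1 "(n - 1) * L + 1" L] by (cases n) (auto simp: add_ac simp del: upt_Suc)
  then show ?thesis by (simp add: first_pts_def batch_def)
qed

lemma sum_batches:
  fixes n L :: nat
  shows
  "(\<Sum>t=1..n * L. F t) = (\<Sum>j=1..n. \<Sum>i<L. F ((j - 1) * L + 1 + i) :: real)"
proof (induction n)
  case (Suc n)
  have "(\<Sum>t=1..Suc n * L. F t) = (\<Sum>t=1..n * L. F t) + (\<Sum>t=n * L + 1..n * L + L. F t)"
    using sum.ub_add_nat[of 1 "n * L" F L] by (simp add: add.commute)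
  also have "(\<Sum>t=n * L + 1..n * L + L. F t) = (\<Sum>i<L. F (n * L + 1 + i))"
    by (rule sum.reindex_bij_witness[of _ "\<lambda>i. n * L + 1 + i" "\<lambda>t. t - (n * L + 1)"]) auto
  finally show ?case using Suc by simp
qed simp

lemma set_first_pts_subset:
  assumes "\<And>j. j \<in> {1..n} \<Longrightarrow> set (batch xs L j) \<subseteq> X"
  shows "set (first_pts xs (n * L)) \<subseteq> X"
  using assms
proof (induction n)
  case 0
  then show ?case by (simp add: first_pts_def)
next
  case (Suc n)
  have "first_pts xs (Suc n * L) = first_pts xs (n * L) @ batch xs L (Suc n)"
    using first_pts_append_batch[of "Suc n" xs L] by simp
  then show ?case using Suc.IH Suc.prems by auto
qed

text \<open>Induction over rounds with \<open>det_append\<close>; both factors are positive, so the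
  logarithm splits.\<close>

lemma ln_det_batches:
  assumes K: "kernel_on X k" and \<sigma>: "\<sigma> > 0"
    and b: "\<And>j. j \<in> {1..n} \<Longrightarrow> set (batch xs L j) \<subseteq> X"
  shows "ln (det (1\<^sub>m (n * L) + (1 / \<sigma>\<^sup>2) \<cdot>\<^sub>m kmat k (first_pts xs (n * L)) (first_pts xs (n * L))))
    = (\<Sum>j=1..n. ln (det (1\<^sub>m L + (1 / \<sigma>\<^sup>2) \<cdot>\<^sub>m post_cov k \<sigma> (first_pts xs ((j - 1) * L)) (batch xs L j))))"
  using b
proof (induction n)
  case 0
  have "1\<^sub>m 0 + (1 / \<sigma>\<^sup>2) \<cdot>\<^sub>m kmat k (first_pts xs 0) (first_pts xs 0) = 1\<^sub>m 0"
    by (intro eq_matI) auto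
  then show ?case by simp
next
  case (Suc n)
  let ?P = "first_pts xs (n * L)" and ?Z = "batch xs L (Suc n)"
  have P: "set ?P \<subseteq> X" using Suc.prems by (intro set_first_pts_subset) auto
  have Z: "set ?Z \<subseteq> X" using Suc.prems by auto
  interpret gp_posterior X k \<sigma> ?P by unfold_locales (use K \<sigma> P in auto)
  have e: "first_pts xs (Suc n * L) = ?P @ ?Z"
    using first_pts_append_batch[of "Suc n" xs L] by simp
  have s: "1 / \<sigma>\<^sup>2 > 0" using \<sigma> by simp
  let ?dP = "det (1\<^sub>m (n * L) + (1 / \<sigma>\<^sup>2) \<cdot>\<^sub>m kmat k ?P ?P)" and ?dZ = "det (1\<^sub>m L + (1 / \<sigma>\<^sup>2) \<cdot>\<^sub>m post_cov k \<sigma> ?P ?Z)"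
  have "?dP > 0"
    using psd_ln_det_bounds(1)[OF kmat_carrier kmat_sym_psd[OF K P] s] by simp
  moreover have "?dZ > 0"
    using psd_ln_det_bounds(1)[OF post_cov_sym_psd[OF Z] s] by simp
  moreover have "det (1\<^sub>m (Suc n * L) + (1 / \<sigma>\<^sup>2) \<cdot>\<^sub>m kmat k (first_pts xs (Suc n * L)) (first_pts xs (Suc n * L))) = ?dP * ?dZ"
    unfolding e using det_append[OF Z] by (simp add: add.commute)
  ultimately show ?case using Suc by (simp add: ln_mult_pos)
qed

text \<open>The supremum is over a bounded set: log-determinants are at most the trace over
  \<open>\<sigma>\<^sup>2\<close>, hence at most \<open>T * B / \<sigma>\<^sup>2\<close>.\<close>

lemma info_gain_upper:
  assumes K: "kernel_on X k" and \<sigma>: "\<sigma> > 0" and B: "\<And>x. x \<in> X \<Longrightarrow> k x x \<le> B"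
    and P: "length P = T" "set P \<subseteq> X"
  shows "ln (det (1\<^sub>m T + (1 / \<sigma>\<^sup>2) \<cdot>\<^sub>m kmat k P P)) / 2 \<le> info_gain k \<sigma> X T"
  unfolding info_gain_def
proof (rule cSUP_upper)
  have s: "1 / \<sigma>\<^sup>2 > 0" using \<sigma> by simp
  show "bdd_above ((\<lambda>P. ln (det (1\<^sub>m T + (1 / \<sigma>\<^sup>2) \<cdot>\<^sub>m kmat k P P)) / 2) ` {P. length P = T \<and> set P \<subseteq> X})"
  proof (rule bdd_aboveI2)
    fix Q assume "Q \<in> {P. length P = T \<and> set P \<subseteq> X}"
    then have Q: "length Q = T" "set Q \<subseteq> X" by auto
    have "ln (det (1\<^sub>m T + (1 / \<sigma>\<^sup>2) \<cdot>\<^sub>m kmat k Q Q)) \<le> 1 / \<sigma>\<^sup>2 * mat_trace (kmat k Q Q)"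
      using psd_ln_det_bounds(2)[OF kmat_carrier kmat_sym_psd[OF K Q(2)] s] Q by simp
    also have "mat_trace (kmat k Q Q) = (\<Sum>i<T. k (Q ! i) (Q ! i))"
      using Q by (simp add: mat_trace_def)
    also have "1 / \<sigma>\<^sup>2 * \<dots> \<le> 1 / \<sigma>\<^sup>2 * (\<Sum>i<T. B)"
      using Q s by (intro mult_left_mono sum_mono B) auto
    finally show "ln (det (1\<^sub>m T + (1 / \<sigma>\<^sup>2) \<cdot>\<^sub>m kmat k Q Q)) / 2 \<le> (1 / \<sigma>\<^sup>2 * (\<Sum>i<T. B)) / 2"
      by (rule divide_right_mono) simp
  qed
qed (use P in auto)

text \<open>Cauchy--Schwarz against the constant 1.\<close>

lemma sum_sqrt_le:
  fixes a :: "'i \<Rightarrow> real"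
  assumes "\<And>i. i \<in> I \<Longrightarrow> a i \<ge> 0"
  shows "(\<Sum>i\<in>I. sqrt (a i)) \<le> sqrt (card I * (\<Sum>i\<in>I. a i))"
proof (rule real_le_rsqrt)
  have "(\<Sum>i\<in>I. sqrt (a i) * 1)\<^sup>2 \<le> (\<Sum>i\<in>I. (sqrt (a i))\<^sup>2) * (\<Sum>i\<in>I. 1\<^sup>2)"
    by (rule Cauchy_Schwarz_ineq_sum)
  then show "(\<Sum>i\<in>I. sqrt (a i))\<^sup>2 \<le> card I * (\<Sum>i\<in>I. a i)"
    using assms by (simp add: mult.commute)
qed

text \<open>The norm inequality for the point mass at \<open>x\<close>, whose form is
  \<open>\<sigma>\<^sup>2\<close>.\<close>

lemma rkhs_dirac_pointwise_bound:
  assumes "rkhs_mem (\<lambda>x y. \<sigma>\<^sup>2 * dirac x y) X g" "\<sigma> > 0" "x \<in> X"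
  shows "\<bar>g x\<bar> \<le> rkhs_norm (\<lambda>x y. \<sigma>\<^sup>2 * dirac x y) X g * \<sigma>"
  using rkhs_norm_bound[OF kernel_on_dirac assms(1), of "{x}" "\<lambda>_. 1"] assms(2,3)
  by (simp add: kform_dirac)

theorem theorem6:
  fixes X :: "'a::euclidean_space set"
    and k :: "'a \<Rightarrow> 'a \<Rightarrow> real"
    and \<sigma> B :: real
    and f g :: "'a \<Rightarrow> real"
    and N L :: nat
    and xs :: "nat \<Rightarrow> 'a"
    and xstar :: 'a
  assumes "compact X"
    and "kernel_on X k"
    and "\<sigma> > 0"
    and "\<forall>x\<in>X. \<forall>y\<in>X. k x y + \<sigma>\<^sup>2 * dirac x y \<le> B"
    and "rkhs_mem k X f"
    and "rkhs_mem (\<lambda>x y. \<sigma>\<^sup>2 * dirac x y) X g"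
    and "N \<ge> 1" and "L \<ge> 1"
    and "\<forall>n\<in>{1..N}. set (batch xs L n) \<subseteq> X \<and>
           (\<forall>Z. length Z = L \<and> set Z \<subseteq> X \<longrightarrow>
              acq k \<sigma> (\<lambda>x. f x + g x)
                  (rkhs_norm (\<lambda>x y. k x y + \<sigma>\<^sup>2 * dirac x y) X (\<lambda>x. f x + g x))
                  xs L n Z
              \<le> acq k \<sigma> (\<lambda>x. f x + g x)
                  (rkhs_norm (\<lambda>x y. k x y + \<sigma>\<^sup>2 * dirac x y) X (\<lambda>x. f x + g x))
                  xs L n (batch xs L n))"
    and "inj_on xs {1..N * L}"
    and "xstar \<in> X" and "\<forall>x\<in>X. f x \<le> f xstar"
    and "(MAX n\<in>{1..N}. spec_norm (post_cov k \<sigma> (first_pts xs ((n - 1) * L)) (batch xs L n))) > 0"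
  shows
    "let T = N * L;
         hn = rkhs_norm (\<lambda>x y. k x y + \<sigma>\<^sup>2 * dirac x y) X (\<lambda>x. f x + g x);
         gn = rkhs_norm (\<lambda>x y. \<sigma>\<^sup>2 * dirac x y) X g;
         \<beta> = (MAX n\<in>{1..N}. spec_norm (post_cov k \<sigma> (first_pts xs ((n - 1) * L)) (batch xs L n)));
         C4 = 8 * \<beta> / ln (1 + \<beta> / \<sigma>\<^sup>2);
         \<gamma> = info_gain k \<sigma> X T
     in (\<Sum>t=1..T. f xstar - f (xs t)) \<le> hn * sqrt (real T * C4 * \<gamma>) + 2 * real T * (hn + gn) * \<sigma>
      \<and> f xstar - (MAX t\<in>{1..T}. f (xs t)) \<le> hn * sqrt (C4 * \<gamma> / real T) + 2 * (hn + gn) * \<sigma>"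
proof -
  define k\<sigma> where "k\<sigma> = (\<lambda>x y. k x y + \<sigma>\<^sup>2 * dirac x y)"
  define h where "h = (\<lambda>x. f x + g x)"
  define hn where "hn = rkhs_norm k\<sigma> X h"
  define gn where "gn = rkhs_norm (\<lambda>x y. \<sigma>\<^sup>2 * dirac x y) X g"
  define PC where "PC n = post_cov k \<sigma> (first_pts xs ((n - 1) * L)) (batch xs L n)" for n
  define \<beta> where "\<beta> = (MAX n\<in>{1..N}. spec_norm (PC n))"
  define C4 where "C4 = 8 * \<beta> / ln (1 + \<beta> / \<sigma>\<^sup>2)"
  define T where "T = N * L"
  define \<gamma> where "\<gamma> = info_gain k \<sigma> X T"
  define tr where "tr n = mat_trace (PC n)" for n
  note K = \<open>kernel_on X k\<close> and \<sigma> = \<open>\<sigma> > 0\<close>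
  have sgn: "1 / \<sigma>\<^sup>2 > 0" using \<sigma> by simp
  have Kd: "kernel_on X (\<lambda>x y. \<sigma>\<^sup>2 * dirac x y)" by (rule kernel_on_dirac) simp
  have K\<sigma>: "kernel_on X k\<sigma>" unfolding k\<sigma>_def by (rule kernel_on_add[OF K Kd])
  have h: "rkhs_mem k\<sigma> X h"
    unfolding k\<sigma>_def h_def by (rule rkhs_mem_add[OF K Kd]) fact+
  have hn0: "hn \<ge> 0" unfolding hn_def by (rule rkhs_norm_nonneg[OF K\<sigma> h])
  have g: "\<bar>g x\<bar> \<le> gn * \<sigma>" if "x \<in> X" for x
    unfolding gn_def by (rule rkhs_dirac_pointwise_bound[OF assms(6) \<sigma> that])
  have bX: "set (batch xs L n) \<subseteq> X" if "n \<in> {1..N}" for n using assms(9) that by blast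
  have pX: "set (first_pts xs ((n - 1) * L)) \<subseteq> X" if "n \<in> {1..N}" for n
    using that by (intro set_first_pts_subset bX) auto
  have post: "gp_posterior X k \<sigma> (first_pts xs ((n - 1) * L))" if "n \<in> {1..N}" for n
    by unfold_locales (use K \<sigma> pX[OF that] in auto)
  \<comment> \<open>\<open>batch_regret\<close> concerns \<open>h\<close>; returning to
    \<open>f\<close> costs \<open>gn * \<sigma>\<close> once at \<open>xstar\<close> and once for
    the average of \<open>g\<close> over the batch.\<close>
  have regret: "f xstar - (\<Sum>i<L. f (batch xs L n ! i)) / L \<le> 2 * hn * sqrt (tr n / L) + 2 * (hn + gn) * \<sigma>"
    if n: "n \<in> {1..N}" for n
  proof -
    let ?P = "first_pts xs ((n - 1) * L)" and ?Z = "batch xs L n"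
    interpret gp_posterior X k \<sigma> ?P by (rule post[OF n])
    have lZ: "length ?Z = L" using n by simp
    have "?P @ ?Z = first_pts xs (n * L)" using n by (intro first_pts_append_batch) simp
    moreover have "{1..<a + 1} \<subseteq> {1..b}" if "a \<le> b" for a b :: nat using that by auto
    then have "{1..<n * L + 1} \<subseteq> {1..N * L}" using n mult_le_mono1 by simp
    ultimately have d: "distinct (?P @ ?Z)"
      using inj_on_subset[OF \<open>inj_on xs {1..N * L}\<close>] by (simp add: first_pts_def distinct_map del: upt_Suc)
    \<comment> \<open>Candidates may contain repetitions, so \<open>L\<close> copies of
      \<open>xstar\<close> compete with the chosen batch.\<close>
    have le: "acq k \<sigma> h hn xs L n (replicate L xstar) \<le> acq k \<sigma> h hn xs L n ?Z"
      unfolding h_def hn_def k\<sigma>_def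
      by (rule bspec[OF assms(9) n, THEN conjunct2, rule_format]) (use \<open>xstar \<in> X\<close> in auto)
    have ne: "?Z \<noteq> []" using lZ \<open>L \<ge> 1\<close> by auto
    have hr: "h xstar - (\<Sum>i<L. h (?Z ! i)) / L \<le> 2 * hn * sqrt (tr n / L) + 2 * hn * \<sigma>"
      unfolding hn_def k\<sigma>_def tr_def PC_def
      by (rule batch_regret[of h ?Z xstar, unfolded lZ length_replicate,
            OF h[unfolded k\<sigma>_def] d bX[OF n] ne \<open>xstar \<in> X\<close> le[unfolded acq_def Let_def hn_def k\<sigma>_def]])
    have zX: "?Z ! i \<in> X" if "i < L" for i using bX[OF n] that lZ by (metis nth_mem subsetD)
    have "(\<Sum>i<L. g (?Z ! i)) \<le> (\<Sum>i<L. gn * \<sigma>)"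
      using g zX by (intro sum_mono) (auto simp: abs_le_iff)
    then have "(\<Sum>i<L. g (?Z ! i)) / L \<le> gn * \<sigma>" using \<open>L \<ge> 1\<close> by (simp add: field_simps)
    moreover have "- g xstar \<le> gn * \<sigma>" using g[OF \<open>xstar \<in> X\<close>] by simp
    ultimately show ?thesis
      using hr by (simp add: h_def sum.distrib add_divide_distrib algebra_simps)
  qed
  have PCp: "PC n \<in> carrier_mat L L"
    "\<And>i j. i < L \<Longrightarrow> j < L \<Longrightarrow> PC n $$ (i, j) = PC n $$ (j, i)"
    "\<And>u. 0 \<le> (\<Sum>i<L. \<Sum>j<L. u i * u j * PC n $$ (i, j))" if "n \<in> {1..N}" for n
    using gp_posterior.post_cov_sym_psd[OF post[OF that] bX[OF that]] that by (simp_all add: PC_def)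
  have tr0: "tr n \<ge> 0" if n: "n \<in> {1..N}" for n
  proof -
    \<comment> \<open>The form at the \<open>i\<close>-th unit vector is the diagonal entry.\<close>
    have "0 \<le> PC n $$ (i, i)" if "i < L" for i
      using PCp(3)[OF n, of "\<lambda>j. if j = i then 1 else 0"] that
      by (simp add: if_distrib[of "\<lambda>z. z * _"] if_distrib[of "\<lambda>z. _ * z"] cong: if_cong)
    then show ?thesis using PCp(1)[OF n] by (auto simp: tr_def mat_trace_def intro!: sum_nonneg)
  qed
  have \<beta>0: "\<beta> > 0" using assms(13) by (simp add: \<beta>_def PC_def)
  have ln0: "ln (1 + \<beta> / \<sigma>\<^sup>2) > 0" using \<beta>0 \<sigma> by (intro ln_gt_zero) simp
  have trn: "tr n * ln (1 + \<beta> / \<sigma>\<^sup>2) \<le> \<beta> * ln (det (1\<^sub>m L + (1 / \<sigma>\<^sup>2) \<cdot>\<^sub>m PC n))" if n: "n \<in> {1..N}" for n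
  proof -
    have "spec_norm (PC n) \<le> \<beta>" unfolding \<beta>_def using n by (intro Max_ge) auto
    then show ?thesis
      using psd_ln_det_bounds(3)[OF PCp[OF n] sgn \<beta>0] by (simp add: tr_def)
  qed
  \<comment> \<open>The bounds of the rounds are added, because the log-determinants sum to that of
    all \<open>T\<close> points.\<close>
  have "(\<Sum>n=1..N. tr n) * ln (1 + \<beta> / \<sigma>\<^sup>2) \<le> \<beta> * (\<Sum>n=1..N. ln (det (1\<^sub>m L + (1 / \<sigma>\<^sup>2) \<cdot>\<^sub>m PC n)))"
    unfolding sum_distrib_left sum_distrib_right by (intro sum_mono trn)
  also have "(\<Sum>n=1..N. ln (det (1\<^sub>m L + (1 / \<sigma>\<^sup>2) \<cdot>\<^sub>m PC n)))
      = ln (det (1\<^sub>m T + (1 / \<sigma>\<^sup>2) \<cdot>\<^sub>m kmat k (first_pts xs T) (first_pts xs T)))"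
    unfolding PC_def T_def by (rule ln_det_batches[symmetric, OF K \<sigma> bX])
  \<comment> \<open>The factor 2 undoes the one half in \<open>info_gain\<close>.\<close>
  also have "\<dots> \<le> 2 * \<gamma>"
  proof -
    \<comment> \<open>On the diagonal the kernel bounded by \<open>B\<close> exceeds
      \<open>k\<close> by \<open>\<sigma>\<^sup>2\<close>.\<close>
    have "k x x \<le> B" if "x \<in> X" for x
      using assms(4) that by (fastforce simp: dirac_def intro: order_trans[rotated])
    moreover have "set (first_pts xs T) \<subseteq> X" unfolding T_def by (intro set_first_pts_subset bX)
    ultimately show ?thesis
      using info_gain_upper[OF K \<sigma>, of B "first_pts xs T" T] by (simp add: \<gamma>_def)
  qed
  finally have "(\<Sum>n=1..N. tr n) * ln (1 + \<beta> / \<sigma>\<^sup>2) \<le> \<beta> * (2 * \<gamma>)" using \<beta>0 by simp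
  \<comment> \<open>The 4 is the square of the 2 in front of \<open>hn\<close> in
    \<open>regret\<close>; with the 2 of \<open>2 * \<gamma>\<close> it makes the 8 in
    \<open>C4\<close>.\<close>
  then have tr_le: "4 * (\<Sum>n=1..N. tr n) \<le> C4 * \<gamma>"
    using ln0 by (simp add: C4_def field_simps)
  have T0: "real T > 0" using \<open>N \<ge> 1\<close> \<open>L \<ge> 1\<close> by (simp add: T_def)
  have "(\<Sum>t=1..T. f xstar - f (xs t)) = (\<Sum>n=1..N. \<Sum>i<L. f xstar - f (xs ((n - 1) * L + 1 + i)))"
    unfolding T_def by (rule sum_batches)
  also have "\<dots> = (\<Sum>n=1..N. L * (f xstar - (\<Sum>i<L. f (batch xs L n ! i)) / L))"
    using \<open>L \<ge> 1\<close> by (intro sum.cong refl) (simp add: batch_nth sum_subtractf right_diff_distrib)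
  also have "\<dots> \<le> (\<Sum>n=1..N. L * (2 * hn * sqrt (tr n / L) + 2 * (hn + gn) * \<sigma>))"
    by (intro sum_mono mult_left_mono regret) auto
  also have "\<dots> = 2 * hn * (\<Sum>n=1..N. sqrt (L * tr n)) + 2 * T * (hn + gn) * \<sigma>"
  proof -
    have "L * sqrt (tr n / L) = sqrt (L * tr n)" for n
      using \<open>L \<ge> 1\<close> by (simp add: real_sqrt_divide real_sqrt_mult real_div_sqrt flip: times_divide_eq_left)
    then have "L * (2 * hn * sqrt (tr n / L) + 2 * (hn + gn) * \<sigma>)
        = 2 * hn * sqrt (L * tr n) + L * (2 * (hn + gn) * \<sigma>)" for n
      by (metis (no_types, opaque_lifting) distrib_left mult.left_commute)
    then show ?thesis by (simp add: sum.distrib sum_distrib_left T_def)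
  qed
  \<comment> \<open>Cauchy--Schwarz over the \<open>N\<close> rounds; the factors \<open>N\<close>
    and \<open>L\<close> combine to \<open>T\<close>.\<close>
  also have "\<dots> \<le> 2 * hn * sqrt (T * (\<Sum>n=1..N. tr n)) + 2 * T * (hn + gn) * \<sigma>"
    using sum_sqrt_le[of "{1..N}" "\<lambda>n. real L * tr n"] tr0 hn0
    by (intro add_right_mono mult_left_mono) (simp_all add: T_def sum_distrib_left[symmetric] mult.assoc)
  also have "2 * hn * sqrt (T * (\<Sum>n=1..N. tr n)) = hn * sqrt (T * (4 * (\<Sum>n=1..N. tr n)))"
    by (simp add: real_sqrt_mult)
  also have "\<dots> + 2 * T * (hn + gn) * \<sigma> \<le> hn * sqrt (T * (C4 * \<gamma>)) + 2 * T * (hn + gn) * \<sigma>"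
    using tr_le hn0 T0 by (intro add_right_mono mult_left_mono) auto
  finally have R: "(\<Sum>t=1..T. f xstar - f (xs t)) \<le> hn * sqrt (T * C4 * \<gamma>) + 2 * T * (hn + gn) * \<sigma>"
    by (simp add: mult.assoc)
  \<comment> \<open>The best queried value is at least every queried value, so \<open>T\<close>
    times the simple regret is at most the cumulative regret.\<close>
  have "T * (f xstar - (MAX t\<in>{1..T}. f (xs t))) = (\<Sum>t=1..T. f xstar - (MAX t\<in>{1..T}. f (xs t)))"
    by simp
  also have "\<dots> \<le> (\<Sum>t=1..T. f xstar - f (xs t))"
    by (intro sum_mono diff_left_mono Max_ge) auto
  also note R
  finally have "f xstar - (MAX t\<in>{1..T}. f (xs t)) \<le> (hn * sqrt (T * C4 * \<gamma>) + 2 * T * (hn + gn) * \<sigma>) / T"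
    using T0 by (simp add: field_simps)
  also have "\<dots> = hn * (sqrt (T * C4 * \<gamma>) / T) + 2 * (hn + gn) * \<sigma>"
    using T0 by (simp add: add_divide_distrib)
  also have "sqrt (T * C4 * \<gamma>) / T = sqrt (C4 * \<gamma> / T)"
  proof -
    have "sqrt (C4 * \<gamma> / T) = sqrt (T * C4 * \<gamma> / (real T)\<^sup>2)"
      using T0 by (simp add: power2_eq_square)
    then show ?thesis using T0 by (simp add: real_sqrt_divide)
  qed
  finally have "f xstar - (MAX t\<in>{1..T}. f (xs t)) \<le> hn * sqrt (C4 * \<gamma> / T) + 2 * (hn + gn) * \<sigma>" .
  with R show ?thesis
    unfolding Let_def T_def \<gamma>_def C4_def \<beta>_def PC_def hn_def gn_def h_def k\<sigma>_def by simp
qed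

end
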